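(* Let $A$ be a finite-dimensional complex Hilbert space with orthonormal basis $\{|i\rangle\}_{i=1}^{|A|}$, let $A'$ be a Hilbert space isomorphic to $A$ with corresponding orthonormal basis $\{|i\rangle\}$, and let $|\Phi\rangle=\sum_{i=1}^{|A|}|i\rangle\otimes|i\rangle\in A\otimes A'$. For any non-commutative graph $S\subseteq\mathcal{L}(A)$, $$\widetilde{\vartheta}(S)=\max\ \langle\Phi|(\mathbf{1}\otimes\rho+T')|\Phi\rangle,$$ where the maximum is over all $\rho\in\mathcal{L}(A')$ and $T'\in\mathcal{L}(A\otimes A')$ subject to $$T'\in S^\perp\otimes\mathcal{L}(A'),\quad \operatorname{Tr}\rho=1,\quad \mathbf{1}\otimes\rho+T'\ge 0,\quad \rho\ge 0.$$
   Context: $\mathcal{L}(A)$ is the space of linear operators on $A$, and $|A|=\dim A$. A non-commutative graph is a linear subspace $S\subseteq\mathcal{L}(A)$ with $\mathbf{1}\in S$ and $S=S^\dagger$. $S^\perp$ is the orthogonal complement in $\mathcal{L}(A)$ with respect to the Hilbert-Schmidt inner product $\operatorname{Tr}X^\dagger Y$. $\|\cdot\|$ is the operator norm. Define $\vartheta(S):=\max\{\|\mathbf{1}+T\|: T\in S^\perp,\ \mathbf{1}+T\ge 0\}$ and the quantum Lovász function $$\widetilde{\vartheta}(S):=\sup_{n\in\mathbb{N}}\vartheta\bigl(S\otimes\mathcal{L}(\mathbb{C}^n)\bigr)=\sup_n\max\{\|\mathbf{1}+T\|: T\in S^\perp\otimes\mathcal{L}(\mathbb{C}^n),\ \mathbf{1}+T\ge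 0\}.$$ *)

theory Defs
  imports
    "HOL-Library.Extended_Real"
    "Jordan_Normal_Form.Schur_Decomposition"
    "Jordan_Normal_Form.VS_Connect"
begin

text \<open>
  A complex Hilbert space of dimension \<open>m\<close> with a chosen orthonormal basis is represented by its
  coordinate space \<open>carrier_vec m\<close> and its operators by \<open>carrier_mat m m\<close>. Basis indices start
  at 0. The product basis vector \<open>|i> \<otimes> |k>\<close> of a space of dimension \<open>p * q\<close> has
  index \<open>i * q + k\<close>.
\<close>

definition tensor_vec :: "complex vec \<Rightarrow> complex vec \<Rightarrow> complex vec" where
  "tensor_vec u v = vec (dim_vec u * dim_vec v)
     (\<lambda>i. u $ (i div dim_vec v) * v $ (i mod dim_vec v))"

definition tensor_mat :: "complex mat \<Rightarrow> complex mat \<Rightarrow> complex mat" where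
  "tensor_mat X Y = mat (dim_row X * dim_row Y) (dim_col X * dim_col Y)
     (\<lambda>(i, j). X $$ (i div dim_row Y, j div dim_col Y) * Y $$ (i mod dim_row Y, j mod dim_col Y))"

definition tensor_space :: "nat \<Rightarrow> nat \<Rightarrow> complex mat set \<Rightarrow> complex mat set \<Rightarrow> complex mat set" where
  "tensor_space p q S U =
     LinearCombinations.module.span class_ring (module_mat TYPE(complex) (p * q) (p * q))
       {tensor_mat X Y | X Y. X \<in> S \<and> Y \<in> U}"

definition mat_trace :: "complex mat \<Rightarrow> complex" where
  "mat_trace M = (\<Sum>i<dim_row M. M $$ (i, i))"

definition nc_graph :: "nat \<Rightarrow> complex mat set \<Rightarrow> bool" where
  "nc_graph m S \<longleftrightarrow>
     VectorSpace.subspace class_ring S (module_mat TYPE(complex) m m) \<and>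
     1\<^sub>m m \<in> S \<and> mat_adjoint ` S = S"

definition hs_perp :: "nat \<Rightarrow> complex mat set \<Rightarrow> complex mat set" where
  "hs_perp m S = {T \<in> carrier_mat m m. \<forall>X\<in>S. mat_trace (mat_adjoint X * T) = 0}"

text \<open>
  \<open>(M *\<^sub>v v) \<bullet>c v\<close> is \<open><v|M|v>\<close>, since \<open>\<bullet>c\<close> conjugates its second argument. In the order on
  \<^typ>\<open>complex\<close>, \<open>0 \<le> z\<close> says that \<open>z\<close> is real and nonnegative, so that \<open>psd\<close> operators are
  self-adjoint.
\<close>

definition psd :: "nat \<Rightarrow> complex mat \<Rightarrow> bool" where
  "psd m M \<longleftrightarrow> M \<in> carrier_mat m m \<and> (\<forall>v\<in>carrier_vec m. 0 \<le> (M *\<^sub>v v) \<bullet>c v)"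

definition hilbert_norm :: "complex vec \<Rightarrow> real" where
  "hilbert_norm v = sqrt (Re (v \<bullet>c v))"

definition operator_norm :: "complex mat \<Rightarrow> real" where
  "operator_norm M = Sup {hilbert_norm (M *\<^sub>v v) | v. v \<in> carrier_vec (dim_col M) \<and> hilbert_norm v \<le> 1}"

definition lovasz :: "nat \<Rightarrow> complex mat set \<Rightarrow> real" where
  "lovasz m S = (GREATEST r. \<exists>T \<in> hs_perp m S. psd m (1\<^sub>m m + T) \<and> r = operator_norm (1\<^sub>m m + T))"

text \<open>
  The supremum is taken in the extended reals, where it always exists; equating it with a real
  number therefore includes its finiteness.
\<close>

definition quantum_lovasz :: "nat \<Rightarrow> complex mat set \<Rightarrow> ereal" where
  "quantum_lovasz m S =
     (SUP n\<in>{1..}. ereal (lovasz (m * n) (tensor_space m n S (carrier_mat n n))))"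

definition phi_vec :: "nat \<Rightarrow> complex vec" where
  "phi_vec d = finsum_vec TYPE(complex) (d * d) (\<lambda>i. tensor_vec (unit_vec d i) (unit_vec d i)) {..<d}"

definition feasible :: "nat \<Rightarrow> complex mat set \<Rightarrow> complex mat \<Rightarrow> complex mat \<Rightarrow> bool" where
  "feasible d S \<rho> T' \<longleftrightarrow>
     \<rho> \<in> carrier_mat d d \<and>
     T' \<in> tensor_space d d (hs_perp d S) (carrier_mat d d) \<and>
     mat_trace \<rho> = 1 \<and>
     psd (d * d) (tensor_mat (1\<^sub>m d) \<rho> + T') \<and>
     psd d \<rho>"

definition objective :: "nat \<Rightarrow> complex mat \<Rightarrow> complex mat \<Rightarrow> complex" where
  "objective d \<rho> T' = ((tensor_mat (1\<^sub>m d) \<rho> + T') *\<^sub>v phi_vec d) \<bullet>c phi_vec d"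

end

theory Submission
  imports Defs "HOL-Analysis.Function_Topology" "HOL-Analysis.Topology_Euclidean_Space"
begin

text \<open>
  Every vector of \<open>A \<otimes> \<complex>\<^sup>n\<close> has the form \<open>(1 \<otimes> M) \<Phi>\<close>. If it is a unit vector on which \<open>1 + T\<close> attains
  its norm, then \<open>\<rho> = M\<^sup>* M\<close> and \<open>T' = (1 \<otimes> M)\<^sup>* T (1 \<otimes> M)\<close> are feasible with objective \<open>\<parallel>1 + T\<parallel>\<close>.
  Conversely, a feasible pair with \<open>\<rho>\<close> invertible comes in this way from
  \<open>T = (1 \<otimes> W)\<^sup>* T' (1 \<otimes> W)\<close> with \<open>n = |A|\<close>, where \<open>W\<^sup>* \<rho> W = 1\<close> and \<open>M = W\<^sup>-\<^sup>1\<close>. A singular \<open>\<rho>\<close> is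
  approximated by invertible ones. Hence the supremum over \<open>n\<close> is already reached at \<open>n = |A|\<close>, and
  both maxima are attained there because the maximum defining \<open>\<theta>\<close> is, by compactness.
\<close>

unbundle no inner_syntax
unbundle no vec_syntax
hide_const (open) Finite_Cartesian_Product.vec Finite_Cartesian_Product.mat
hide_type (open) Finite_Cartesian_Product.vec

section \<open>Adjoints, positive operators and tensor products\<close>

lemma dim_mat_adjoint [simp]:
  fixes A :: "complex mat"
  shows "dim_row (mat_adjoint A) = dim_col A" "dim_col (mat_adjoint A) = dim_row A"
  unfolding mat_adjoint_def by simp_all

lemma mat_adjoint_carrier [simp, intro]:
  fixes A :: "complex mat"
  shows "A \<in> carrier_mat n m \<Longrightarrow> mat_adjoint A \<in> carrier_mat m n"
  by (intro carrier_matI) (simp_all add: carrier_matD)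

lemma index_mat_adjoint [simp]:
  fixes A :: "complex mat"
  assumes "i < dim_col A" "j < dim_row A"
  shows "mat_adjoint A $$ (i, j) = cnj (A $$ (j, i))"
proof -
  have "mat_adjoint A $$ (i, j) = (map conjugate (cols A) ! i) $ j"
    unfolding mat_adjoint_def by (rule mat_of_rows_index) (use assms in auto)
  also have "\<dots> = conjugate (col A i) $ j" using assms by simp
  also have "\<dots> = conjugate (col A i $ j)" by (rule vec_index_conjugate) (use assms in simp)
  also have "\<dots> = cnj (A $$ (j, i))" using assms by simp
  finally show ?thesis .
qed

lemma index_mult_mat_sum:
  assumes "i < dim_row A" "j < dim_col B" "dim_col A = dim_row B"
  shows "(A * B) $$ (i, j) = (\<Sum>k<dim_row B. A $$ (i, k) * B $$ (k, j))"
  using assms by (simp add: scalar_prod_def atLeast0LessThan)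

lemma mat_adjoint_mult:
  fixes A B :: "complex mat"
  assumes "A \<in> carrier_mat n k" "B \<in> carrier_mat k m"
  shows "mat_adjoint (A * B) = mat_adjoint B * mat_adjoint A"
proof (rule eq_matI)
  fix i j assume "i < dim_row (mat_adjoint B * mat_adjoint A)" "j < dim_col (mat_adjoint B * mat_adjoint A)"
  then have "i < m" "j < n" using assms by auto
  then show "mat_adjoint (A * B) $$ (i, j) = (mat_adjoint B * mat_adjoint A) $$ (i, j)"
    using assms by (simp add: index_mult_mat_sum mult.commute del: index_mult_mat(1))
qed (use assms in auto)

lemma mat_adjoint_one [simp]: "mat_adjoint (1\<^sub>m n :: complex mat) = 1\<^sub>m n"
  by (intro eq_matI) auto

lemma cscalar_sum: "v \<bullet>c w = (\<Sum>i<dim_vec w. v $ i * cnj (w $ i))" for v w :: "complex vec"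
  by (simp add: scalar_prod_def atLeast0LessThan)

lemma mult_mat_vec_cscalar:
  fixes A :: "complex mat"
  assumes "A \<in> carrier_mat n m" "v \<in> carrier_vec m" "w \<in> carrier_vec n"
  shows "(A *\<^sub>v v) \<bullet>c w = v \<bullet>c (mat_adjoint A *\<^sub>v w)"
proof -
  have "(A *\<^sub>v v) \<bullet>c w = (\<Sum>i<n. \<Sum>j<m. A $$ (i, j) * v $ j * cnj (w $ i))"
    using assms by (simp add: cscalar_sum scalar_prod_def atLeast0LessThan sum_distrib_right)
  also have "\<dots> = (\<Sum>j<m. \<Sum>i<n. A $$ (i, j) * v $ j * cnj (w $ i))"
    by (rule sum.swap)
  also have "\<dots> = v \<bullet>c (mat_adjoint A *\<^sub>v w)"
    using assms by (simp add: cscalar_sum scalar_prod_def atLeast0LessThan sum_distrib_left mult_ac)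
  finally show ?thesis .
qed

text \<open>A^* moves across the inner product. Two vectors are allowed so that matrix entries as
  well as quadratic forms can be read off, and A may be rectangular so that the dimension can
  change.\<close>

lemma congruence_cscalar:
  fixes A M :: "complex mat"
  assumes "M \<in> carrier_mat n n" "A \<in> carrier_mat n k" "v \<in> carrier_vec k" "w \<in> carrier_vec k"
  shows "((mat_adjoint A * M * A) *\<^sub>v v) \<bullet>c w = (M *\<^sub>v (A *\<^sub>v v)) \<bullet>c (A *\<^sub>v w)"
proof -
  have "(mat_adjoint A * M * A) *\<^sub>v v = mat_adjoint A *\<^sub>v (M *\<^sub>v (A *\<^sub>v v))"
  proof -
    have "mat_adjoint A * M \<in> carrier_mat k n" "A *\<^sub>v v \<in> carrier_vec n"
      using assms by auto
    then show ?thesis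
      using assms by (metis assoc_mult_mat_vec mat_adjoint_carrier)
  qed
  moreover have "mat_adjoint (mat_adjoint A) = A"
    by (intro eq_matI) auto
  ultimately show ?thesis
    using mult_mat_vec_cscalar[of "mat_adjoint A" k n "M *\<^sub>v (A *\<^sub>v v)" w] assms by simp
qed

lemma psd_congruence:
  assumes "psd n M" "A \<in> carrier_mat n k"
  shows "psd k (mat_adjoint A * M * A)"
  using assms by (auto simp: psd_def congruence_cscalar[of M n A k])

lemma psd_add: "psd n M \<Longrightarrow> psd n N \<Longrightarrow> psd n (M + N)"
  by (auto simp: psd_def add_mult_distrib_mat_vec[of _ n n] add_scalar_prod_distrib[of _ n])

lemma smult_mat_cscalar:
  fixes M :: "complex mat"
  assumes "M \<in> carrier_mat n n" "v \<in> carrier_vec n" "w \<in> carrier_vec n"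
  shows "((c \<cdot>\<^sub>m M) *\<^sub>v v) \<bullet>c w = c * ((M *\<^sub>v v) \<bullet>c w)"
  using assms by (simp add: cscalar_sum sum_distrib_left mult.assoc)

lemma psd_smult:
  assumes "psd n M" "0 \<le> c"
  shows "psd n (c \<cdot>\<^sub>m M)"
  using assms by (auto simp: psd_def smult_mat_cscalar[of _ n])

lemma cscalar_self: "v \<bullet>c v = complex_of_real (\<Sum>i<dim_vec v. (cmod (v $ i))\<^sup>2)" for v :: "complex vec"
  unfolding cscalar_sum of_real_sum by (simp add: complex_norm_square del: of_real_power)

lemma psd_one: "psd n (1\<^sub>m n)"
  by (auto simp: psd_def)

lemma mat_trace_mult:
  assumes "X \<in> carrier_mat n m" "T \<in> carrier_mat m n"
  shows "mat_trace (X * T) = (\<Sum>i<n. \<Sum>k<m. X $$ (i, k) * T $$ (k, i))"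
  using assms by (simp add: mat_trace_def index_mult_mat_sum del: index_mult_mat(1))

lemma mat_trace_add:
  assumes "X \<in> carrier_mat n n" "T \<in> carrier_mat n n"
  shows "mat_trace (X + T) = mat_trace X + mat_trace T"
  using assms by (simp add: mat_trace_def sum.distrib)

lemma mat_trace_smult:
  assumes "X \<in> carrier_mat n n"
  shows "mat_trace (c \<cdot>\<^sub>m X) = c * mat_trace X"
  using assms by (simp add: mat_trace_def sum_distrib_left)

section \<open>Kronecker products through block indices\<close>

lemma div_mod_mult_add [simp]:
  fixes i k q :: nat
  assumes "k < q"
  shows "(i * q + k) div q = i" "(i * q + k) mod q = k"
  using assms by auto

lemma mult_add_less_mult: "i * q + k < p * q" if "i < p" "k < q" for i k p q :: nat
proof -
  have "i * q + k < (i + 1) * q" using that by simp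
  also have "\<dots> \<le> p * q" using that by (intro mult_right_mono) auto
  finally show ?thesis .
qed

text \<open>The range splits into p consecutive blocks of length q, as in the numbering of a product
  basis.\<close>

lemma sum_lessThan_mult:
  "(\<Sum>t<p * q. f t) = (\<Sum>i<p. \<Sum>k<q. f (i * q + k))" for p q :: nat and f :: "nat \<Rightarrow> complex"
proof -
  have "(\<Sum>t<p * q. f t) = (\<Sum>i<p. sum f {i * q..<i * q + q})"
    by (simp add: sum.nat_group)
  moreover have "sum f {i * q..<i * q + q} = (\<Sum>k<q. f (i * q + k))" for i
    using sum.shift_bounds_nat_ivl[of f 0 "i * q" q]
    by (simp add: atLeast0LessThan add.commute)
  ultimately show ?thesis by simp
qed

lemma lessThan_mult_cases:
  fixes t p q :: nat
  assumes "t < p * q"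
  obtains i k where "t = i * q + k" "i < p" "k < q"
proof (rule that[of "t div q" "t mod q"])
  have "q > 0" using assms by (cases q) auto
  then show "t mod q < q" by simp
qed (use assms in \<open>auto simp: less_mult_imp_div_less\<close>)

lemma dim_tensor_mat [simp]:
  "dim_row (tensor_mat X Y) = dim_row X * dim_row Y"
  "dim_col (tensor_mat X Y) = dim_col X * dim_col Y"
  by (simp_all add: tensor_mat_def)

lemma tensor_mat_carrier [simp, intro]:
  "X \<in> carrier_mat p p' \<Longrightarrow> Y \<in> carrier_mat q q' \<Longrightarrow> tensor_mat X Y \<in> carrier_mat (p * q) (p' * q')"
  by (intro carrier_matI) (simp_all add: carrier_matD)

lemma index_tensor_mat [simp]:
  assumes "X \<in> carrier_mat p p'" "Y \<in> carrier_mat q q'" "i < p" "j < p'" "k < q" "l < q'"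
  shows "tensor_mat X Y $$ (i * q + k, j * q' + l) = X $$ (i, j) * Y $$ (k, l)"
  using assms by (simp add: tensor_mat_def mult_add_less_mult)

text \<open>Every index below p * q has the form i * q + k, the form in which
  \<open>index_tensor_mat\<close> evaluates entries.\<close>

lemma eq_mat_blockI:
  assumes "A \<in> carrier_mat (p * q) (p' * q')" "B \<in> carrier_mat (p * q) (p' * q')"
    and "\<And>i j k l. i < p \<Longrightarrow> j < p' \<Longrightarrow> k < q \<Longrightarrow> l < q' \<Longrightarrow>
      A $$ (i * q + k, j * q' + l) = B $$ (i * q + k, j * q' + l)"
  shows "A = B"
proof (rule eq_matI)
  fix s t assume "s < dim_row B" "t < dim_col B"
  then have "s < p * q" "t < p' * q'" using assms(2) by auto
  then show "A $$ (s, t) = B $$ (s, t)"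
    by (elim lessThan_mult_cases) (simp add: assms(3))
qed (use assms(1,2) in auto)

lemma tensor_mat_mult:
  fixes X X' Y Y' :: "complex mat"
  assumes "X \<in> carrier_mat p p'" "X' \<in> carrier_mat p' p''"
    "Y \<in> carrier_mat q q'" "Y' \<in> carrier_mat q' q''"
  shows "tensor_mat X Y * tensor_mat X' Y' = tensor_mat (X * X') (Y * Y')"
proof (rule eq_mat_blockI[where p = p and q = q and p' = p'' and q' = q''])
  fix i j k l
  assume ind: "i < p" "j < p''" "k < q" "l < q''"
  have "(tensor_mat X Y * tensor_mat X' Y') $$ (i * q + k, j * q'' + l)
      = (\<Sum>a<p'. \<Sum>b<q'. (X $$ (i, a) * Y $$ (k, b)) * (X' $$ (a, j) * Y' $$ (b, l)))"
    using assms ind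
    by (simp add: index_mult_mat_sum mult_add_less_mult sum_lessThan_mult index_tensor_mat[of _ p p' _ q q']
        index_tensor_mat[of _ p' p'' _ q' q'']  del: index_mult_mat(1))
  also have "\<dots> = (\<Sum>a<p'. X $$ (i, a) * X' $$ (a, j)) * (\<Sum>b<q'. Y $$ (k, b) * Y' $$ (b, l))"
    by (simp add: sum_product mult_ac)
  also have "\<dots> = tensor_mat (X * X') (Y * Y') $$ (i * q + k, j * q'' + l)"
    using assms ind
    by (simp add: index_tensor_mat[of _ p p'' _ q q''] index_mult_mat_sum del: index_mult_mat(1))
  finally show "(tensor_mat X Y * tensor_mat X' Y') $$ (i * q + k, j * q'' + l)
      = tensor_mat (X * X') (Y * Y') $$ (i * q + k, j * q'' + l)" .
qed (use assms in auto)

lemma tensor_mat_adjoint: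
  fixes X Y :: "complex mat"
  assumes "X \<in> carrier_mat p p'" "Y \<in> carrier_mat q q'"
  shows "mat_adjoint (tensor_mat X Y) = tensor_mat (mat_adjoint X) (mat_adjoint Y)"
proof (rule eq_mat_blockI[where p = p' and q = q' and p' = p and q' = q])
  fix i j k l
  assume "i < p'" "j < p" "k < q'" "l < q"
  then show "mat_adjoint (tensor_mat X Y) $$ (i * q' + k, j * q + l)
      = tensor_mat (mat_adjoint X) (mat_adjoint Y) $$ (i * q' + k, j * q + l)"
    using assms by (simp add: mult_add_less_mult index_tensor_mat[of _ p p' _ q q']
        index_tensor_mat[of _ p' p _ q' q])
qed (use assms in auto)

lemma tensor_mat_one: "tensor_mat (1\<^sub>m p) (1\<^sub>m q) = 1\<^sub>m (p * q)"
proof (rule eq_mat_blockI[where p = p and q = q and p' = p and q' = q])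
  fix i j k l
  assume ind: "i < p" "j < p" "k < q" "l < q"
  then have "i * q + k = j * q + l \<longleftrightarrow> i = j \<and> k = l"
    by (metis div_mod_mult_add)
  then show "tensor_mat (1\<^sub>m p) (1\<^sub>m q) $$ (i * q + k, j * q + l) = 1\<^sub>m (p * q) $$ (i * q + k, j * q + l)"
    using ind by (simp add: index_tensor_mat[of _ p p _ q q] mult_add_less_mult)
qed auto

lemma tensor_mat_add_right:
  assumes "X \<in> carrier_mat p p'" "Y \<in> carrier_mat q q'" "Y' \<in> carrier_mat q q'"
  shows "tensor_mat X (Y + Y') = tensor_mat X Y + tensor_mat X Y'"
  using assms
  by (intro eq_mat_blockI[of _ p q p' q'])
    (auto simp: index_tensor_mat[of _ p p' _ q q'] mult_add_less_mult distrib_left)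

lemma tensor_mat_smult_right:
  assumes "X \<in> carrier_mat p p'" "Y \<in> carrier_mat q q'"
  shows "tensor_mat X (c \<cdot>\<^sub>m Y) = c \<cdot>\<^sub>m tensor_mat X Y"
  using assms
  by (intro eq_mat_blockI[of _ p q p' q'])
    (auto simp: index_tensor_mat[of _ p p' _ q q'] mult_add_less_mult)

lemma mat_trace_tensor:
  assumes "X \<in> carrier_mat p p" "Y \<in> carrier_mat q q"
  shows "mat_trace (tensor_mat X Y) = mat_trace X * mat_trace Y"
  using assms by (simp add: mat_trace_def sum_lessThan_mult sum_product index_tensor_mat[of _ p p _ q q])

section \<open>Tensor products of operator spaces as spans of elementary tensors\<close>

context
  fixes p q :: nat and P U :: "complex mat set"
  assumes carrier: "P \<subseteq> carrier_mat p p" "U \<subseteq> carrier_mat q q"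
begin

interpretation matrix_vs "p * q" "p * q" "TYPE(complex)" .

lemma tensor_generators_carrier: "{tensor_mat X Y | X Y. X \<in> P \<and> Y \<in> U} \<subseteq> carrier_mat (p * q) (p * q)"
  using carrier by blast

lemma tensor_space_submodule: "submodule class_ring (tensor_space p q P U) V"
  unfolding tensor_space_def by (rule span_is_submodule) (rule tensor_generators_carrier)

lemma tensor_space_carrier: "T \<in> tensor_space p q P U \<Longrightarrow> T \<in> carrier_mat (p * q) (p * q)"
  using submodule.subset[OF tensor_space_submodule] by (auto simp: matrix_vs_simps)

lemma tensor_space_gen: "X \<in> P \<Longrightarrow> Y \<in> U \<Longrightarrow> tensor_mat X Y \<in> tensor_space p q P U"
  unfolding tensor_space_def using in_own_span[OF tensor_generators_carrier] by blast

lemma tensor_space_zero: "0\<^sub>m (p * q) (p * q) \<in> tensor_space p q P U"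
  using submodule.zero_closed[OF tensor_space_submodule] by (simp add: matrix_vs_simps)

lemma tensor_space_add:
  "T \<in> tensor_space p q P U \<Longrightarrow> T' \<in> tensor_space p q P U \<Longrightarrow> T + T' \<in> tensor_space p q P U"
  using submodule.m_closed[OF tensor_space_submodule] by (simp add: matrix_vs_simps)

lemma tensor_space_smult:
  "T \<in> tensor_space p q P U \<Longrightarrow> c \<cdot>\<^sub>m T \<in> tensor_space p q P U"
  using submodule.smult_closed[OF tensor_space_submodule, of c] by (simp add: matrix_vs_simps)

text \<open>The matrices with property Q form a submodule that contains the generators, hence it
  contains their span.\<close>

lemma tensor_space_induct_aux:
  assumes "T \<in> tensor_space p q P U"
    and "\<And>X Y. X \<in> P \<Longrightarrow> Y \<in> U \<Longrightarrow> Q (tensor_mat X Y)"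
    and "Q (0\<^sub>m (p * q) (p * q))"
    and "\<And>T T'. T \<in> carrier_mat (p * q) (p * q) \<Longrightarrow> T' \<in> carrier_mat (p * q) (p * q) \<Longrightarrow>
      Q T \<Longrightarrow> Q T' \<Longrightarrow> Q (T + T')"
    and "\<And>c T. T \<in> carrier_mat (p * q) (p * q) \<Longrightarrow> Q T \<Longrightarrow> Q (c \<cdot>\<^sub>m T)"
  shows "Q T"
proof -
  have "submodule class_ring {T \<in> carrier_mat (p * q) (p * q). Q T} V"
    unfolding submodule_def using module_axioms assms(3-5)
    by (auto simp: matrix_vs_simps)
  moreover have "{tensor_mat X Y | X Y. X \<in> P \<and> Y \<in> U} \<subseteq> {T \<in> carrier_mat (p * q) (p * q). Q T}"
    using tensor_generators_carrier assms(2) by blast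
  ultimately show ?thesis
    using span_is_subset assms(1) unfolding tensor_space_def by blast
qed

end

text \<open>The three consumed facts are the two carrier inclusions of the context and the
  membership of T.\<close>

lemmas tensor_space_induct [consumes 3, case_names gen zero add smult] = tensor_space_induct_aux

section \<open>Congruence by 1 \<otimes> B and orthogonal complements of tensor products\<close>

lemma hs_inner_sum:
  assumes "X \<in> carrier_mat n m" "T \<in> carrier_mat n m"
  shows "mat_trace (mat_adjoint X * T) = (\<Sum>i<m. \<Sum>k<n. cnj (X $$ (k, i)) * T $$ (k, i))"
proof -
  have "mat_trace (mat_adjoint X * T) = (\<Sum>i<m. \<Sum>k<n. mat_adjoint X $$ (i, k) * T $$ (k, i))"
    using assms by (intro mat_trace_mult) auto
  then show ?thesis using assms by simp
qed

lemma hs_perp_carrier: "hs_perp n S \<subseteq> carrier_mat n n"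
  by (auto simp: hs_perp_def)

lemma hs_perpD: "T \<in> hs_perp n S \<Longrightarrow> X \<in> S \<Longrightarrow> mat_trace (mat_adjoint X * T) = 0"
  by (simp add: hs_perp_def)

text \<open>On generators the congruence sends X \<otimes> Y to X \<otimes> B^* Y B, leaving the
  first factor alone; the rest is linearity. A rectangular B changes the dimension of the second
  factor from q to r.\<close>

lemma tensor_space_congruence:
  assumes P: "P \<subseteq> carrier_mat p p" and T: "T \<in> tensor_space p q P (carrier_mat q q)"
    and B: "B \<in> carrier_mat q r"
  shows "mat_adjoint (tensor_mat (1\<^sub>m p) B) * T * tensor_mat (1\<^sub>m p) B
    \<in> tensor_space p r P (carrier_mat r r)"
proof -
  let ?A = "tensor_mat (1\<^sub>m p) B"
  have A: "?A \<in> carrier_mat (p * q) (p * r)" "mat_adjoint ?A \<in> carrier_mat (p * r) (p * q)"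
    using B by auto
  show ?thesis
    using P subset_refl T
  proof (induction rule: tensor_space_induct)
    case (gen X Y)
    then have X: "X \<in> carrier_mat p p" and Y: "Y \<in> carrier_mat q q" using P by auto
    have "mat_adjoint ?A * tensor_mat X Y = tensor_mat X (mat_adjoint B * Y)"
      unfolding tensor_mat_adjoint[OF one_carrier_mat B]
      using tensor_mat_mult[OF one_carrier_mat X mat_adjoint_carrier[OF B] Y] X by simp
    then have "mat_adjoint ?A * tensor_mat X Y * ?A = tensor_mat X (mat_adjoint B * Y * B)"
      using tensor_mat_mult[OF X one_carrier_mat mult_carrier_mat[OF mat_adjoint_carrier[OF B] Y] B] X by simp
    moreover have "mat_adjoint B * Y * B \<in> carrier_mat r r"
      using B gen by auto
    ultimately show ?case
      using tensor_space_gen[OF P subset_refl] gen by auto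
  next
    case zero
    have "mat_adjoint ?A * 0\<^sub>m (p * q) (p * q) * ?A = 0\<^sub>m (p * r) (p * r)"
      unfolding right_mult_zero_mat[OF A(2)] by (rule left_mult_zero_mat[OF A(1)])
    then show ?case
      using tensor_space_zero[OF P subset_refl] by simp
  next
    case (add T T')
    have "mat_adjoint ?A * (T + T') * ?A = mat_adjoint ?A * T * ?A + mat_adjoint ?A * T' * ?A"
      unfolding mult_add_distrib_mat[OF A(2) add(1,2)]
      by (rule add_mult_distrib_mat[OF mult_carrier_mat[OF A(2) add(1)] mult_carrier_mat[OF A(2) add(2)] A(1)])
    then show ?case
      using tensor_space_add[OF P subset_refl add(3,4)] by simp
  next
    case (smult c T)
    have "mat_adjoint ?A * (c \<cdot>\<^sub>m T) * ?A = c \<cdot>\<^sub>m (mat_adjoint ?A * T * ?A)"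
      unfolding mult_smult_distrib[OF A(2) smult(1)]
      by (rule mult_smult_assoc_mat[OF mult_carrier_mat[OF A(2) smult(1)] A(1)])
    then show ?case
      using tensor_space_smult[OF P subset_refl smult(2)] by simp
  qed
qed

text \<open>Elementary tensors from the two sides are orthogonal because the trace factors, and
  sesquilinearity extends this to the spans. Conversely, T is the sum of the tensors
  \<open>block k l\<close> \<otimes> \<open>E k l\<close>, and every block of an orthogonal T is
  orthogonal to S.\<close>

lemma hs_perp_tensor_space:
  assumes S: "S \<subseteq> carrier_mat p p"
  shows "hs_perp (p * q) (tensor_space p q S (carrier_mat q q))
    = tensor_space p q (hs_perp p S) (carrier_mat q q)" (is "hs_perp _ ?S = ?P")
proof (intro equalityI subsetI)
  fix T assume T: "T \<in> ?P"
  have T': "T \<in> carrier_mat (p * q) (p * q)"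
    using tensor_space_carrier[OF hs_perp_carrier subset_refl T] .
  have "mat_trace (mat_adjoint X * T) = 0" if "X \<in> ?S" for X
    using S subset_refl that
  proof (induction rule: tensor_space_induct)
    case (gen X Y)
    then have X: "X \<in> carrier_mat p p" and Y: "Y \<in> carrier_mat q q"
      using S by auto
    have XY: "tensor_mat X Y \<in> carrier_mat (p * q) (p * q)"
      using X Y by auto
    \<comment> \<open>A second induction, now on T with the generator X \<otimes> Y fixed, reduces
      the claim to two elementary tensors.\<close>
    from hs_perp_carrier subset_refl T show ?case
    proof (induction rule: tensor_space_induct)
      case (gen X' Y')
      then have X': "X' \<in> carrier_mat p p" "mat_trace (mat_adjoint X * X') = 0"
        using hs_perp_carrier hs_perpD[of X' p S X] \<open>X \<in> S\<close> by auto
      have "mat_adjoint (tensor_mat X Y) * tensor_mat X' Y' = tensor_mat (mat_adjoint X * X') (mat_adjoint Y * Y')"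
        using X Y X' gen by (simp add: tensor_mat_adjoint[of _ p p _ q q] tensor_mat_mult[of _ p p _ p _ q q _ q])
      then show ?case
        using mat_trace_tensor[OF mult_carrier_mat[OF mat_adjoint_carrier[OF X] X'(1)]
            mult_carrier_mat[OF mat_adjoint_carrier[OF Y] gen(2)]] X'(2) by simp
    qed (use XY in \<open>simp_all add: hs_inner_sum[of _ "p * q" "p * q"] sum.distrib distrib_left
        sum_distrib_left[symmetric] mult.left_commute\<close>)
  qed (use T' in \<open>simp_all add: hs_inner_sum[of _ "p * q" "p * q"] sum.distrib distrib_right
        sum_distrib_left[symmetric] mult.assoc\<close>)
  with T' show "T \<in> hs_perp (p * q) ?S"
    by (simp add: hs_perp_def)
next
  fix T assume T: "T \<in> hs_perp (p * q) ?S"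
  then have T': "T \<in> carrier_mat (p * q) (p * q)"
    by (simp add: hs_perp_def)
  \<comment> \<open>\<open>block k l\<close> collects the entries of T with second-factor indices k
    and l, and \<open>E k l\<close> is a matrix unit. \<open>mask K\<close> keeps the entries whose
    second-factor indices lie in K, so it grows from 0 to T as pairs are inserted.\<close>
  define block where "block k l = mat p p (\<lambda>(i, j). T $$ (i * q + k, j * q + l))" for k l
  define E :: "nat \<Rightarrow> nat \<Rightarrow> complex mat" where "E k l = mat q q (\<lambda>s. if s = (k, l) then 1 else 0)" for k l
  define mask where "mask K = mat (p * q) (p * q) (\<lambda>(s, t). if (s mod q, t mod q) \<in> K then T $$ (s, t) else 0)" for K
  have E: "E k l \<in> carrier_mat q q" and block: "block k l \<in> carrier_mat p p" for k l
    by (simp_all add: E_def block_def)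
  have block_perp: "block k l \<in> hs_perp p S" if kl: "k < q" "l < q" for k l
  proof -
    have "mat_trace (mat_adjoint X * block k l) = 0" if "X \<in> S" for X
    proof -
      have X: "X \<in> carrier_mat p p" using that S by auto
      \<comment> \<open>Testing T against X \<otimes> \<open>E k l\<close> leaves exactly the inner
        product of X with \<open>block k l\<close>.\<close>
      have "0 = mat_trace (mat_adjoint (tensor_mat X (E k l)) * T)"
        using hs_perpD[OF T tensor_space_gen[OF S subset_refl that E[of k l]]] by simp
      also have "\<dots> = (\<Sum>i<p. \<Sum>b<q. \<Sum>j<p. \<Sum>a<q.
          cnj (tensor_mat X (E k l) $$ (j * q + a, i * q + b)) * T $$ (j * q + a, i * q + b))"
        using X E T' by (simp add: hs_inner_sum[of _ "p * q" "p * q"] sum_lessThan_mult)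
      also have "\<dots> = (\<Sum>i<p. \<Sum>b<q. \<Sum>j<p. \<Sum>a<q.
          if a = k then if b = l then cnj (X $$ (j, i)) * T $$ (j * q + a, i * q + b) else 0 else 0)"
        using X E[of k l] by (intro sum.cong refl) (simp add: index_tensor_mat[of _ p p _ q q], simp add: E_def)
      also have "\<dots> = (\<Sum>i<p. \<Sum>j<p. cnj (X $$ (j, i)) * T $$ (j * q + k, i * q + l))"
        using kl by (simp add: sum.swap[of _ "{..<p}" "{..<q}"])
      also have "\<dots> = mat_trace (mat_adjoint X * block k l)"
        using X block by (simp add: hs_inner_sum[of _ p p]) (simp add: block_def)
      finally show ?thesis by simp
    qed
    then show ?thesis
      using block by (simp add: hs_perp_def)
  qed
  have "mask K \<in> ?P" if "finite K" "K \<subseteq> {..<q} \<times> {..<q}" for K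
    using that
  proof (induction K)
    case empty
    have "mask {} = 0\<^sub>m (p * q) (p * q)"
      by (auto simp: mask_def)
    then show ?case
      using tensor_space_zero[OF hs_perp_carrier subset_refl] by simp
  next
    case (insert s K)
    obtain k l where s: "s = (k, l)" "k < q" "l < q"
      using insert.prems by (cases s) auto
    have "mask (insert s K) = mask K + tensor_mat (block k l) (E k l)"
    proof (rule eq_mat_blockI[where p = p and q = q and p' = p and q' = q])
      show "mask K + tensor_mat (block k l) (E k l) \<in> carrier_mat (p * q) (p * q)"
        using block E by auto
    next
      fix i j a b assume "i < p" "j < p" "a < q" "b < q"
      then show "mask (insert s K) $$ (i * q + a, j * q + b)
          = (mask K + tensor_mat (block k l) (E k l)) $$ (i * q + a, j * q + b)"
        using block[of k l] E[of k l] insert.hyps s(1)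
        by (simp add: mult_add_less_mult index_tensor_mat[of _ p p _ q q])
          (auto simp: mask_def mult_add_less_mult block_def E_def)
    qed (simp add: mask_def)
    then show ?case
      using tensor_space_add[OF hs_perp_carrier subset_refl]
        tensor_space_gen[OF hs_perp_carrier subset_refl block_perp[OF s(2,3)] E] insert by simp
  qed
  from this[of "{..<q} \<times> {..<q}"] have "mask ({..<q} \<times> {..<q}) \<in> ?P"
    by simp
  moreover have "mask ({..<q} \<times> {..<q}) = T"
    using T' by (intro eq_mat_blockI[of _ p q p q]) (auto simp: mask_def mult_add_less_mult)
  ultimately show "T \<in> ?P" by simp
qed

section \<open>The operator norm of a positive operator\<close>

text \<open>The expression in t is the quadratic form of a positive operator at u + t v, with c and
  e its two mixed terms. That it is real at t = 1 and t = \<i> forces e = cnj c; the inequality is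
  the discriminant argument.\<close>

lemma nonneg_form_Cauchy_Schwarz:
  fixes a b c e :: complex
  assumes "0 \<le> b" and form: "\<And>t. 0 \<le> a + t * e + cnj t * c + t * cnj t * b"
  shows "e = cnj c" "(cmod c)\<^sup>2 \<le> Re a * Re b"
proof -
  have a: "0 \<le> a" using form[of 0] by simp
  have b: "0 \<le> Re b" "Im b = 0" using assms(1) by (auto simp: less_eq_complex_def)
  show e: "e = cnj c"
    using form[of 1] form[of \<i>] a b by (auto simp: less_eq_complex_def complex_eq_iff)
  \<comment> \<open>The choice t = - s c makes both cross terms real and equal to - s times the
    squared modulus of c.\<close>
  have bound: "0 \<le> Re a - 2 * s * (cmod c)\<^sup>2 + s\<^sup>2 * (cmod c)\<^sup>2 * Re b" for s :: real
  proof -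
    have "Re (a + (- of_real s * c) * e + cnj (- of_real s * c) * c + (- of_real s * c) * cnj (- of_real s * c) * b)
        = Re a - 2 * s * (cmod c)\<^sup>2 + s\<^sup>2 * (cmod c)\<^sup>2 * Re b"
      unfolding e using b by (simp add: cmod_def power2_eq_square algebra_simps)
    then show ?thesis
      using form[of "- of_real s * c"] by (simp add: less_eq_complex_def)
  qed
  show "(cmod c)\<^sup>2 \<le> Re a * Re b"
  proof (cases "Re b = 0")
    case True
    have "c = 0"
    proof (rule ccontr)
      assume "c \<noteq> 0"
      then show False
        \<comment> \<open>With Re b = 0 the bound is affine in s; at this s its right-hand side is
          -1.\<close>
        using bound[of "(Re a + 1) / (2 * (cmod c)\<^sup>2)"] True by simp
    qed
    then show ?thesis using True by simp
  next
    case False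
    then have "0 \<le> Re a - (cmod c)\<^sup>2 / Re b"
      \<comment> \<open>This s minimizes the quadratic polynomial whenever c is not 0.\<close>
      using bound[of "1 / Re b"] by (simp add: power2_eq_square field_simps)
    then show ?thesis
      using False b by (simp add: field_simps)
  qed
qed

lemma cscalar_add_smult_expand:
  fixes M :: "complex mat"
  assumes M: "M \<in> carrier_mat n n" and u: "u \<in> carrier_vec n" and v: "v \<in> carrier_vec n"
  shows "(M *\<^sub>v (u + t \<cdot>\<^sub>v v)) \<bullet>c (u + t \<cdot>\<^sub>v v) = (M *\<^sub>v u) \<bullet>c u + t * ((M *\<^sub>v v) \<bullet>c u)
    + cnj t * ((M *\<^sub>v u) \<bullet>c v) + t * cnj t * ((M *\<^sub>v v) \<bullet>c v)"
proof -
  have "M *\<^sub>v (u + t \<cdot>\<^sub>v v) = M *\<^sub>v u + t \<cdot>\<^sub>v (M *\<^sub>v v)"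
    using assms by (simp add: mult_add_distrib_mat_vec[of _ n n] mult_mat_vec[of _ n n])
  moreover have "(x + t \<cdot>\<^sub>v y) \<bullet>c (u + t \<cdot>\<^sub>v v)
      = x \<bullet>c u + t * (y \<bullet>c u) + cnj t * (x \<bullet>c v) + t * cnj t * (y \<bullet>c v)"
    if "x \<in> carrier_vec n" "y \<in> carrier_vec n" for x y
    using that u v
    by (simp add: cscalar_sum distrib_left distrib_right sum.distrib sum_distrib_left mult_ac)
  ultimately show ?thesis
    using M u v by simp
qed

text \<open>Both facts come from expanding the nonnegative form at u + t v. In particular, being
  self-adjoint is derived from the forms being real.\<close>

lemma
  assumes "psd n M" "u \<in> carrier_vec n" "v \<in> carrier_vec n"
  shows psd_hermitian: "(M *\<^sub>v v) \<bullet>c u = cnj ((M *\<^sub>v u) \<bullet>c v)"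
    and psd_Cauchy_Schwarz:
      "(cmod ((M *\<^sub>v u) \<bullet>c v))\<^sup>2 \<le> Re ((M *\<^sub>v u) \<bullet>c u) * Re ((M *\<^sub>v v) \<bullet>c v)"
proof -
  have M: "M \<in> carrier_mat n n" and nonneg: "0 \<le> (M *\<^sub>v w) \<bullet>c w" if "w \<in> carrier_vec n" for w
    using assms(1) that by (auto simp: psd_def)
  have "0 \<le> (M *\<^sub>v u) \<bullet>c u + t * ((M *\<^sub>v v) \<bullet>c u)
    + cnj t * ((M *\<^sub>v u) \<bullet>c v) + t * cnj t * ((M *\<^sub>v v) \<bullet>c v)" for t
    using nonneg[of "u + t \<cdot>\<^sub>v v"] assms(2,3)
    by (simp add: cscalar_add_smult_expand[OF M[OF assms(2)] assms(2,3)])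
  from nonneg_form_Cauchy_Schwarz[OF nonneg[OF assms(3)] this]
  show "(M *\<^sub>v v) \<bullet>c u = cnj ((M *\<^sub>v u) \<bullet>c v)"
    "(cmod ((M *\<^sub>v u) \<bullet>c v))\<^sup>2 \<le> Re ((M *\<^sub>v u) \<bullet>c u) * Re ((M *\<^sub>v v) \<bullet>c v)" .
qed

lemma hilbert_norm_power2: "(hilbert_norm v)\<^sup>2 = Re (v \<bullet>c v)"
  by (simp add: hilbert_norm_def cscalar_self sum_nonneg)

lemma hilbert_norm_nonneg [simp]: "0 \<le> hilbert_norm v"
  by (simp add: hilbert_norm_def cscalar_self sum_nonneg)

lemma cmod_cscalar_le:
  assumes "u \<in> carrier_vec n" "v \<in> carrier_vec n"
  shows "cmod (u \<bullet>c v) \<le> hilbert_norm u * hilbert_norm v"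
proof (rule power2_le_imp_le)
  show "(cmod (u \<bullet>c v))\<^sup>2 \<le> (hilbert_norm u * hilbert_norm v)\<^sup>2"
    using psd_Cauchy_Schwarz[OF psd_one assms] assms
    by (simp add: power_mult_distrib hilbert_norm_power2)
qed simp

text \<open>This replaces the spectral theorem. Cauchy-Schwarz for the form of M, applied to v and w
  = M v, bounds the fourth power of the norm of w by the product of the forms at v and w; the bound
  on the form then allows cancelling the squared norm of w.\<close>

lemma psd_hilbert_norm_mult_le:
  assumes "psd n M" "v \<in> carrier_vec n"
    and bound: "\<And>w. w \<in> carrier_vec n \<Longrightarrow> Re ((M *\<^sub>v w) \<bullet>c w) \<le> r * (hilbert_norm w)\<^sup>2"
    and "0 \<le> r"
  shows "hilbert_norm (M *\<^sub>v v) \<le> r * hilbert_norm v"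
proof -
  let ?w = "M *\<^sub>v v"
  have w: "?w \<in> carrier_vec n" using assms(1,2) by (auto simp: psd_def)
  have nonneg: "0 \<le> Re ((M *\<^sub>v u) \<bullet>c u)" if "u \<in> carrier_vec n" for u
    using assms(1) that by (auto simp: psd_def less_eq_complex_def)
  have "(hilbert_norm ?w)\<^sup>2 * (hilbert_norm ?w)\<^sup>2 = (cmod (?w \<bullet>c ?w))\<^sup>2"
    unfolding hilbert_norm_power2 cscalar_self by (simp add: power2_eq_square del: of_real_sum)
  also have "\<dots> \<le> Re ((M *\<^sub>v v) \<bullet>c v) * Re ((M *\<^sub>v ?w) \<bullet>c ?w)"
    by (rule psd_Cauchy_Schwarz[OF assms(1,2) w])
  also have "\<dots> \<le> (r * (hilbert_norm v)\<^sup>2) * (r * (hilbert_norm ?w)\<^sup>2)"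
    using nonneg[OF w] \<open>0 \<le> r\<close> by (intro mult_mono bound assms(2) w) auto
  finally have "(hilbert_norm ?w)\<^sup>2 * (hilbert_norm ?w)\<^sup>2 \<le> (r * hilbert_norm v)\<^sup>2 * (hilbert_norm ?w)\<^sup>2"
    by (simp add: power_mult_distrib power2_eq_square mult_ac)
  then have "hilbert_norm ?w = 0 \<or> (hilbert_norm ?w)\<^sup>2 \<le> (r * hilbert_norm v)\<^sup>2"
    using zero_less_power2[of "hilbert_norm ?w"] by (metis mult_le_cancel_right_pos)
  then show ?thesis
    using \<open>0 \<le> r\<close> by (auto intro: power2_le_imp_le)
qed

lemma hilbert_norm_smult: "hilbert_norm (c \<cdot>\<^sub>v v) = cmod c * hilbert_norm v"
proof (rule power2_eq_imp_eq)
  show "(hilbert_norm (c \<cdot>\<^sub>v v))\<^sup>2 = (cmod c * hilbert_norm v)\<^sup>2"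
    by (simp add: hilbert_norm_power2 cscalar_self power_mult_distrib norm_mult sum_distrib_left)
qed simp_all

lemma hilbert_norm_eq_0: "hilbert_norm v = 0 \<longleftrightarrow> v = 0\<^sub>v (dim_vec v)"
proof -
  have "hilbert_norm v = 0 \<longleftrightarrow> (\<Sum>i<dim_vec v. (cmod (v $ i))\<^sup>2) = 0"
    by (simp add: hilbert_norm_def cscalar_self)
  also have "\<dots> \<longleftrightarrow> (\<forall>i<dim_vec v. v $ i = 0)"
    by (subst sum_nonneg_eq_0_iff) auto
  finally show ?thesis by (metis eq_vecI index_zero_vec)
qed

lemma quadratic_form_le_homogeneous:
  fixes M :: "complex mat"
  assumes M: "M \<in> carrier_mat n n" and w: "w \<in> carrier_vec n"
    and unit: "\<And>v. v \<in> carrier_vec n \<Longrightarrow> hilbert_norm v = 1 \<Longrightarrow> Re ((M *\<^sub>v v) \<bullet>c v) \<le> r"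
  shows "Re ((M *\<^sub>v w) \<bullet>c w) \<le> r * (hilbert_norm w)\<^sup>2"
proof (cases "hilbert_norm w = 0")
  case True
  then have "w = 0\<^sub>v n" using w hilbert_norm_eq_0[of w] by simp
  then show ?thesis using M True by simp
next
  case False
  define c where "c = complex_of_real (hilbert_norm w)"
  define v where "v = inverse c \<cdot>\<^sub>v w"
  have v: "v \<in> carrier_vec n" "hilbert_norm v = 1"
    using w False by (auto simp: v_def c_def hilbert_norm_smult norm_inverse)
  have "w = c \<cdot>\<^sub>v v"
    using False w by (intro eq_vecI) (auto simp: v_def c_def)
  moreover have "M *\<^sub>v v \<in> carrier_vec n" using M v by auto
  ultimately have "(M *\<^sub>v w) \<bullet>c w = (c * cnj c) * ((M *\<^sub>v v) \<bullet>c v)"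
    using M v by (simp add: mult_mat_vec[of _ n n] cscalar_sum sum_distrib_left mult_ac del: index_mult_mat_vec)
  also have "c * cnj c = of_real ((hilbert_norm w)\<^sup>2)"
    by (simp add: c_def power2_eq_square)
  finally show ?thesis
    using mult_left_mono[OF unit[OF v], of "(hilbert_norm w)\<^sup>2"] by (simp add: mult.commute del: of_real_power)
qed

text \<open>Together the two parts identify the norm with the supremum of the form over unit
  vectors. The bound r also enters the second part, since it keeps the set under \<open>Sup\<close>
  bounded.\<close>

lemma psd_operator_norm_le:
  assumes "psd n M" "0 \<le> r"
    and unit: "\<And>v. v \<in> carrier_vec n \<Longrightarrow> hilbert_norm v = 1 \<Longrightarrow> Re ((M *\<^sub>v v) \<bullet>c v) \<le> r"
  shows "operator_norm M \<le> r" "v \<in> carrier_vec n \<Longrightarrow> hilbert_norm v = 1 \<Longrightarrow> Re ((M *\<^sub>v v) \<bullet>c v) \<le> operator_norm M"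
proof -
  let ?N = "{hilbert_norm (M *\<^sub>v v) | v. v \<in> carrier_vec (dim_col M) \<and> hilbert_norm v \<le> 1}"
  have M: "M \<in> carrier_mat n n" using assms(1) by (simp add: psd_def)
  have le: "x \<le> r" if x_in: "x \<in> ?N" for x
  proof -
    obtain v where v: "x = hilbert_norm (M *\<^sub>v v)" "v \<in> carrier_vec n" "hilbert_norm v \<le> 1"
      using x_in unfolding carrier_matD(2)[OF M] by blast
    have "hilbert_norm (M *\<^sub>v v) \<le> r * hilbert_norm v"
      using assms M v by (intro psd_hilbert_norm_mult_le quadratic_form_le_homogeneous)
    also have "\<dots> \<le> r" using v \<open>0 \<le> r\<close> by (simp add: mult_left_le)
    finally show ?thesis using v by simp
  qed
  have "hilbert_norm (0\<^sub>v (dim_col M)) = 0" by (simp add: hilbert_norm_eq_0)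
  then have "?N \<noteq> {}"
    by (auto intro!: exI[of _ "0\<^sub>v (dim_col M)"])
  then show "operator_norm M \<le> r"
    unfolding operator_norm_def using le by (rule cSup_least)
  assume v: "v \<in> carrier_vec n" "hilbert_norm v = 1"
  have "Re ((M *\<^sub>v v) \<bullet>c v) \<le> cmod ((M *\<^sub>v v) \<bullet>c v)" by (rule complex_Re_le_cmod)
  also have "\<dots> \<le> hilbert_norm (M *\<^sub>v v)"
    using cmod_cscalar_le[of "M *\<^sub>v v" n v] M v by simp
  also have "\<dots> \<le> operator_norm M"
    unfolding operator_norm_def using M v le by (intro cSup_upper bdd_aboveI[of _ r]) auto
  finally show "Re ((M *\<^sub>v v) \<bullet>c v) \<le> operator_norm M" .
qed

section \<open>Attainment of the maximum in the Lovasz number\<close>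

text \<open>Tychonoff: the set is a product of closed discs. Coding matrices and vectors as
  functions on all indices makes the product topology available.\<close>

lemma compact_bounded_functions: "compact {f :: 'a \<Rightarrow> complex. \<forall>p. norm (f p) \<le> c}"
proof -
  have "{f :: 'a \<Rightarrow> complex. \<forall>p. norm (f p) \<le> c} = PiE UNIV (\<lambda>_. cball 0 c)"
    by (auto simp: PiE_UNIV_domain)
  moreover have "compactin (product_topology (\<lambda>_. euclidean) UNIV) (PiE UNIV (\<lambda>_ :: 'a. cball (0 :: complex) c))"
    by (simp add: compactin_PiE)
  ultimately show ?thesis
    by (simp add: euclidean_product_topology)
qed

lemma mat_trace_one: "mat_trace (1\<^sub>m n) = of_nat n"
  by (simp add: mat_trace_def)

lemma quadratic_form_sum:
  fixes M :: "complex mat"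
  assumes "M \<in> carrier_mat n n" "u \<in> carrier_vec n" "v \<in> carrier_vec n"
  shows "(M *\<^sub>v u) \<bullet>c v = (\<Sum>i<n. (\<Sum>j<n. M $$ (i, j) * u $ j) * cnj (v $ i))"
  using assms by (simp add: cscalar_sum) (simp add: scalar_prod_def atLeast0LessThan)

lemma quadratic_form_unit_vec:
  fixes M :: "complex mat"
  assumes "M \<in> carrier_mat n n" "i < n" "j < n"
  shows "(M *\<^sub>v unit_vec n j) \<bullet>c unit_vec n i = M $$ (i, j)"
  using assms
  by (simp add: quadratic_form_sum[of _ n] if_distrib[of "(*) _"] if_distrib[of cnj] cong: if_cong)

text \<open>Cauchy-Schwarz at two basis vectors bounds an entry by two diagonal entries, which are
  nonnegative and hence at most the trace.\<close>

lemma psd_entry_le_trace: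
  assumes psd: "psd n M" and ij: "i < n" "j < n"
  shows "cmod (M $$ (i, j)) \<le> Re (mat_trace M)"
proof -
  have M: "M \<in> carrier_mat n n" using psd by (simp add: psd_def)
  have diag: "0 \<le> Re (M $$ (a, a))" if "a < n" for a
  proof -
    have "0 \<le> (M *\<^sub>v unit_vec n a) \<bullet>c unit_vec n a"
      using psd unit_vec_carrier[of n a] unfolding psd_def by blast
    then show ?thesis
      unfolding quadratic_form_unit_vec[OF M that that] by (simp add: less_eq_complex_def)
  qed
  have le: "Re (M $$ (a, a)) \<le> Re (mat_trace M)" if "a < n" for a
  proof -
    have "Re (M $$ (a, a)) \<le> (\<Sum>a<n. Re (M $$ (a, a)))"
      using that diag by (intro member_le_sum) auto
    then show ?thesis unfolding mat_trace_def using carrier_matD(1)[OF M] by simp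
  qed
  have "(cmod (M $$ (i, j)))\<^sup>2 \<le> Re (M $$ (j, j)) * Re (M $$ (i, i))"
    using psd_Cauchy_Schwarz[OF psd unit_vec_carrier unit_vec_carrier, of j i]
    unfolding quadratic_form_unit_vec[OF M ij] quadratic_form_unit_vec[OF M ij(1) ij(1)]
      quadratic_form_unit_vec[OF M ij(2) ij(2)] .
  also have "\<dots> \<le> Re (mat_trace M) * Re (mat_trace M)"
    using order_trans[OF diag[OF ij(1)] le[OF ij(1)]]
    by (intro mult_mono le diag ij)
  finally have "(cmod (M $$ (i, j)))\<^sup>2 \<le> (Re (mat_trace M))\<^sup>2"
    by (simp only: power2_eq_square)
  then show ?thesis
    using order_trans[OF diag[OF ij(1)] le[OF ij(1)]] by (rule power2_le_imp_le)
qed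

text \<open>Being orthogonal to 1, T is traceless. With \<open>psd_entry_le_trace\<close> this
  bounds all entries of a positive 1 + T by m.\<close>

lemma hs_perp_one_trace:
  assumes "1\<^sub>m m \<in> S" "T \<in> hs_perp m S"
  shows "mat_trace (1\<^sub>m m + T) = of_nat m"
proof -
  have T: "T \<in> carrier_mat m m" using assms hs_perp_carrier by auto
  have "mat_trace T = 0" using hs_perpD[OF assms(2,1)] T by simp
  then show ?thesis using T by (simp add: mat_trace_add[of _ m] mat_trace_one)
qed

text \<open>Merges the two maximizations: a pair (T, v) that maximizes the form over all admissible
  pairs also gives the largest norm, so the value described by \<open>GREATEST\<close>
  exists.\<close>

lemma lovasz_eqI:
  assumes "0 \<le> r" and T: "T \<in> hs_perp m S" "psd m (1\<^sub>m m + T)"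
    and v: "v \<in> carrier_vec m" "hilbert_norm v = 1" "Re (((1\<^sub>m m + T) *\<^sub>v v) \<bullet>c v) = r"
    and max: "\<And>T v. T \<in> hs_perp m S \<Longrightarrow> psd m (1\<^sub>m m + T) \<Longrightarrow> v \<in> carrier_vec m \<Longrightarrow>
      hilbert_norm v = 1 \<Longrightarrow> Re (((1\<^sub>m m + T) *\<^sub>v v) \<bullet>c v) \<le> r"
  shows "lovasz m S = r"
proof -
  have le: "operator_norm (1\<^sub>m m + T) \<le> r" if "T \<in> hs_perp m S" "psd m (1\<^sub>m m + T)" for T
    using that max \<open>0 \<le> r\<close> by (intro psd_operator_norm_le)
  moreover have "r \<le> operator_norm (1\<^sub>m m + T)"
    using psd_operator_norm_le(2)[OF T(2) \<open>0 \<le> r\<close> max[OF T] v(1,2)] v(3) by simp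
  ultimately have "operator_norm (1\<^sub>m m + T) = r"
    using T by (simp add: antisym)
  then show ?thesis
    unfolding lovasz_def using T le by (intro Greatest_equality) auto
qed

lemma closed_nonneg_complex: "closed {x. 0 \<le> f x}"
  if "continuous_on UNIV f" for f :: "'a :: topological_space \<Rightarrow> complex"
  unfolding less_eq_complex_def
  by (intro closed_Collect_conj closed_Collect_le closed_Collect_eq continuous_intros that)

text \<open>Maximizing the form over pairs (T, v) avoids any continuity statement about the norm:
  the form is continuous in the coordinates, and the pairs are coded by a closed subset of a compact
  set.\<close>

lemma lovasz_attained:
  assumes m: "1 \<le> m" and S: "S \<subseteq> carrier_mat m m" "1\<^sub>m m \<in> S"
  obtains T v where "T \<in> hs_perp m S" "psd m (1\<^sub>m m + T)" "v \<in> carrier_vec m" "hilbert_norm v = 1"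
    "Re (((1\<^sub>m m + T) *\<^sub>v v) \<bullet>c v) = lovasz m S"
    "\<And>T v. T \<in> hs_perp m S \<Longrightarrow> psd m (1\<^sub>m m + T) \<Longrightarrow> v \<in> carrier_vec m \<Longrightarrow>
      hilbert_norm v = 1 \<Longrightarrow> Re (((1\<^sub>m m + T) *\<^sub>v v) \<bullet>c v) \<le> lovasz m S"
proof -
  \<comment> \<open>The bound m comes from the trace of 1 + T, the bound 1 from v being a unit
    vector.\<close>
  define X :: "((nat \<times> nat \<Rightarrow> complex) \<times> (nat \<Rightarrow> complex)) set" where
    "X = {f. \<forall>p. norm (f p) \<le> of_nat m} \<times> {g. \<forall>i. norm (g i) \<le> 1}"
  \<comment> \<open>The first component holds the entries of 1 + T, so the identity is subtracted in
    the orthogonality condition. Positivity and the unit norm of the second component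
    follow.\<close>
  define F where "F = X \<inter>
    ({x. \<forall>Y\<in>S. (\<Sum>i<m. \<Sum>k<m. cnj (Y $$ (k, i)) * (fst x (k, i) - (if k = i then 1 else 0))) = 0}
    \<inter> {x. \<forall>w\<in>carrier_vec m. 0 \<le> (\<Sum>i<m. (\<Sum>j<m. fst x (i, j) * w $ j) * cnj (w $ i))}
    \<inter> {x. (\<Sum>i<m. (cmod (snd x i))\<^sup>2) = 1})"
  define form where "form x = Re (\<Sum>i<m. (\<Sum>j<m. fst x (i, j) * snd x j) * cnj (snd x i))"
    for x :: "(nat \<times> nat \<Rightarrow> complex) \<times> (nat \<Rightarrow> complex)"
  have cont_fst: "continuous_on A (\<lambda>x. fst x p)"
    and cont_snd: "continuous_on A (\<lambda>x. snd x i)"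
    for A :: "((nat \<times> nat \<Rightarrow> complex) \<times> (nat \<Rightarrow> complex)) set" and p i
    by (rule continuous_on_compose2[OF continuous_on_product_coordinates continuous_on_fst]
        continuous_on_compose2[OF continuous_on_product_coordinates continuous_on_snd]; simp)+
  have "compact X"
    unfolding X_def by (intro compact_Times compact_bounded_functions)
  then have "compact F"
    unfolding F_def Ball_def
    by (intro compact_Int_closed closed_Int closed_Collect_all closed_Collect_imp closed_nonneg_complex
        closed_Collect_eq continuous_intros cont_fst cont_snd) auto
  moreover have "continuous_on F form"
    unfolding form_def by (intro continuous_intros cont_fst cont_snd)
  moreover
  have F_of: "\<exists>x\<in>F. form x = Re (((1\<^sub>m m + T) *\<^sub>v v) \<bullet>c v)"
    if T: "T \<in> hs_perp m S" "psd m (1\<^sub>m m + T)" and v: "v \<in> carrier_vec m" "hilbert_norm v = 1" for T v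
  proof
    let ?M = "1\<^sub>m m + T"
    \<comment> \<open>Coordinates outside the matrix are set to 0, which respects the bounds of X;
      the other conditions do not see them.\<close>
    define f where "f = (\<lambda>(i, j). if i < m \<and> j < m then ?M $$ (i, j) else 0)"
    define g where "g i = (if i < m then v $ i else 0)" for i
    have T': "T \<in> carrier_mat m m" using T hs_perp_carrier by auto
    have M: "?M \<in> carrier_mat m m" using T' by simp
    have norm_v: "(\<Sum>i<m. (cmod (v $ i))\<^sup>2) = 1"
      using v hilbert_norm_power2[of v] by (simp add: cscalar_self)
    have "cmod (f p) \<le> real m" for p
      using psd_entry_le_trace[OF T(2)] hs_perp_one_trace[OF S(2) T(1)] by (cases p) (simp add: f_def)
    moreover have "cmod (g i) \<le> 1" for i
    proof (cases "i < m")
      case True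
      then have "(cmod (v $ i))\<^sup>2 \<le> 1"
        using member_le_sum[of i "{..<m}" "\<lambda>i. (cmod (v $ i))\<^sup>2"] norm_v by simp
      then show ?thesis using True by (simp add: g_def power_le_one_iff)
    qed (simp add: g_def)
    moreover have "(\<Sum>i<m. \<Sum>k<m. cnj (Y $$ (k, i)) * (f (k, i) - (if k = i then 1 else 0))) = 0"
      if "Y \<in> S" for Y
    proof -
      have "(\<Sum>i<m. \<Sum>k<m. cnj (Y $$ (k, i)) * (f (k, i) - (if k = i then 1 else 0)))
          = mat_trace (mat_adjoint Y * T)"
        using that S T' by (subst hs_inner_sum[of _ m m]) (auto simp: f_def intro!: sum.cong)
      then show ?thesis using hs_perpD[OF T(1) that] by simp
    qed
    moreover have form: "(\<Sum>i<m. (\<Sum>j<m. f (i, j) * w $ j) * cnj (w $ i)) = (?M *\<^sub>v w) \<bullet>c w"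
      if "w \<in> carrier_vec m" for w
      unfolding quadratic_form_sum[OF M that that] by (simp add: f_def)
    moreover have "0 \<le> (?M *\<^sub>v w) \<bullet>c w" if "w \<in> carrier_vec m" for w
      using T(2) that by (simp add: psd_def)
    moreover have "(\<Sum>i<m. (cmod (g i))\<^sup>2) = 1"
      using norm_v by (simp add: g_def)
    ultimately show "(f, g) \<in> F"
      by (simp add: F_def X_def)
    show "form (f, g) = Re ((?M *\<^sub>v v) \<bullet>c v)"
      using form[OF v(1)] by (simp add: form_def g_def)
  qed
  \<comment> \<open>T = 0 and the first basis vector, which exists since m is positive.\<close>
  moreover have "F \<noteq> {}"
  proof -
    have zero: "0\<^sub>m m m \<in> hs_perp m S"
      using S by (auto simp: hs_perp_def hs_inner_sum[of _ m m] subset_iff)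
    moreover have "psd m (1\<^sub>m m + 0\<^sub>m m m)"
      by (simp add: psd_one)
    moreover have "hilbert_norm (unit_vec m 0) = 1"
      using m by (simp add: hilbert_norm_def)
    ultimately show ?thesis using F_of by (metis unit_vec_carrier empty_iff)
  qed
  ultimately obtain x where x: "x \<in> F" "\<And>y. y \<in> F \<Longrightarrow> form y \<le> form x"
    using continuous_attains_sup[of F form] by blast
  obtain f g where fg: "x = (f, g)" by (cases x)
  \<comment> \<open>The maximizing coordinates are turned back into an operator and a
    vector.\<close>
  define M where "M = mat m m f"
  define T where "T = M - 1\<^sub>m m"
  define v where "v = vec m g"
  have M: "M \<in> carrier_mat m m" and T: "T \<in> carrier_mat m m" and v: "v \<in> carrier_vec m"
    by (auto simp: M_def T_def v_def)
  have MT: "1\<^sub>m m + T = M"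
    using M by (intro eq_matI) (auto simp: T_def)
  have "mat_trace (mat_adjoint Y * T) = 0" if "Y \<in> S" for Y
  proof -
    have "mat_trace (mat_adjoint Y * T)
        = (\<Sum>i<m. \<Sum>k<m. cnj (Y $$ (k, i)) * (f (k, i) - (if k = i then 1 else 0)))"
      using that S T by (subst hs_inner_sum[of _ m m]) (auto simp: T_def M_def intro!: sum.cong)
    then show ?thesis using x(1) that by (simp add: F_def fg)
  qed
  then have T_perp: "T \<in> hs_perp m S"
    using T by (simp add: hs_perp_def)
  have psd: "psd m (1\<^sub>m m + T)"
    unfolding MT psd_def using M x(1) by (auto simp: quadratic_form_sum[of _ m] F_def fg M_def)
  have v1: "hilbert_norm v = 1"
    using x(1) by (simp add: hilbert_norm_def cscalar_self F_def fg v_def)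
  have form: "form x = Re (((1\<^sub>m m + T) *\<^sub>v v) \<bullet>c v)"
    unfolding MT quadratic_form_sum[OF M v v] by (simp add: form_def fg M_def v_def)
  have max: "Re (((1\<^sub>m m + T') *\<^sub>v w) \<bullet>c w) \<le> form x"
    if "T' \<in> hs_perp m S" "psd m (1\<^sub>m m + T')" "w \<in> carrier_vec m" "hilbert_norm w = 1" for T' w
    using F_of[OF that] x(2) by force
  have "0 \<le> form x"
    unfolding form using psd v by (simp add: psd_def less_eq_complex_def)
  then have "lovasz m S = form x"
    using T_perp psd v v1 form max by (intro lovasz_eqI) auto
  with T_perp psd v v1 form max show ?thesis
    by (intro that) auto
qed

section \<open>Congruence of positive definite operators to the identity\<close>

text \<open>Linearity of the form in its first argument, stated for a Gram-Schmidt residual written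
  entrywise.\<close>

lemma mult_mat_vec_cscalar_diff_sum:
  fixes M :: "complex mat" and w :: "nat \<Rightarrow> complex vec"
  assumes "M \<in> carrier_mat n n" "x \<in> carrier_vec n" "y \<in> carrier_vec n" "\<And>l. l < k \<Longrightarrow> w l \<in> carrier_vec n"
  shows "(M *\<^sub>v vec n (\<lambda>i. x $ i - (\<Sum>l<k. c l * w l $ i))) \<bullet>c y
    = (M *\<^sub>v x) \<bullet>c y - (\<Sum>l<k. c l * ((M *\<^sub>v w l) \<bullet>c y))"
proof -
  have "(M *\<^sub>v vec n (\<lambda>i. x $ i - (\<Sum>l<k. c l * w l $ i))) \<bullet>c y
    = (\<Sum>i<n. (\<Sum>j<n. M $$ (i, j) * x $ j) * cnj (y $ i))
      - (\<Sum>i<n. \<Sum>j<n. \<Sum>l<k. c l * (M $$ (i, j) * w l $ j * cnj (y $ i)))"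
    using assms by (simp add: quadratic_form_sum[of _ n] right_diff_distrib left_diff_distrib
      sum_subtractf sum_distrib_left sum_distrib_right mult_ac)
  also have "(\<Sum>i<n. \<Sum>j<n. \<Sum>l<k. c l * (M $$ (i, j) * w l $ j * cnj (y $ i)))
    = (\<Sum>l<k. \<Sum>i<n. \<Sum>j<n. c l * (M $$ (i, j) * w l $ j * cnj (y $ i)))"
    by (simp only: sum.swap[of _ "{..<k}" "{..<n}"])
  finally show ?thesis
    using assms by (simp add: quadratic_form_sum[of _ n] sum_distrib_left sum_distrib_right)
qed

text \<open>
  Gram-Schmidt for the inner product given by \<open>M\<close>, applied to the standard basis. The vectors form
  a triangular array, so that the \<open>k\<close>-th residual has \<open>k\<close>-th entry 1 and does not vanish.
\<close>

lemma posdef_orthonormal_family: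
  assumes psd: "psd n M"
    and pos: "\<And>v. v \<in> carrier_vec n \<Longrightarrow> v \<noteq> 0\<^sub>v n \<Longrightarrow> (M *\<^sub>v v) \<bullet>c v \<noteq> 0"
    and "k \<le> n"
  shows "\<exists>w. (\<forall>i<k. w i \<in> carrier_vec n \<and> (\<forall>j<n. i < j \<longrightarrow> w i $ j = 0)) \<and>
    (\<forall>i<k. \<forall>j<k. (M *\<^sub>v w i) \<bullet>c w j = (if i = j then 1 else 0))"
  using \<open>k \<le> n\<close>
proof (induction k)
  case (Suc k)
  from Suc.prems obtain w where w: "\<And>i. i < k \<Longrightarrow> w i \<in> carrier_vec n"
    and tri: "\<And>i j. i < k \<Longrightarrow> j < n \<Longrightarrow> i < j \<Longrightarrow> w i $ j = 0"
    and orth: "\<And>i j. i < k \<Longrightarrow> j < k \<Longrightarrow> (M *\<^sub>v w i) \<bullet>c w j = (if i = j then 1 else 0)"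
    using Suc.IH[OF Suc_leD] by blast
  have M: "M \<in> carrier_mat n n" using psd by (simp add: psd_def)
  let ?e = "unit_vec n k :: complex vec"
  \<comment> \<open>The residual of the k-th basis vector after removing its components along the
    earlier vectors, measured by the form of M.\<close>
  define u where "u = vec n (\<lambda>i. ?e $ i - (\<Sum>l<k. ((M *\<^sub>v ?e) \<bullet>c w l) * w l $ i))"
  have u: "u \<in> carrier_vec n" by (simp add: u_def)
  have uw: "(M *\<^sub>v u) \<bullet>c w j = 0" if "j < k" for j
  proof -
    have "(M *\<^sub>v u) \<bullet>c w j = (M *\<^sub>v ?e) \<bullet>c w j
        - (\<Sum>l<k. ((M *\<^sub>v ?e) \<bullet>c w l) * ((M *\<^sub>v w l) \<bullet>c w j))"
      unfolding u_def by (rule mult_mat_vec_cscalar_diff_sum) (use M w that in auto)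
    then show ?thesis
      using that by (simp add: orth if_distrib[of "(*) _"] cong: if_cong)
  qed
  have wu: "(M *\<^sub>v w j) \<bullet>c u = 0" if "j < k" for j
    using psd_hermitian[OF psd u w[OF that]] uw[OF that] by simp
  have "u $ k = 1"
    using Suc.prems by (simp add: u_def tri)
  then have "u \<noteq> 0\<^sub>v n" using Suc.prems by auto
  then have "(M *\<^sub>v u) \<bullet>c u \<noteq> 0" "0 \<le> (M *\<^sub>v u) \<bullet>c u"
    using pos u psd by (auto simp: psd_def)
  \<comment> \<open>A nonnegative complex number other than 0 is a positive real, whose square root
    normalizes u.\<close>
  then obtain r where r: "0 < r" "(M *\<^sub>v u) \<bullet>c u = complex_of_real r"
    by (metis complex_eq_iff less_eq_complex_def Re_complex_of_real Im_complex_of_real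
        zero_complex.simps order_le_less)
  define c where "c = complex_of_real (1 / sqrt r)"
  define w' where "w' = w(k := c \<cdot>\<^sub>v u)"
  have tri_u: "u $ j = 0" if "j < n" "k < j" for j
    using that by (simp add: u_def tri)
  have cc: "c * cnj c * complex_of_real r = 1"
    using r by (simp add: c_def flip: of_real_mult)
  have Mu: "M *\<^sub>v u \<in> carrier_vec n" "M *\<^sub>v w i \<in> carrier_vec n" if "i < k" for i
    using M u w[OF that] by auto
  have left: "(M *\<^sub>v (c \<cdot>\<^sub>v u)) \<bullet>c y = c * ((M *\<^sub>v u) \<bullet>c y)" if "y \<in> carrier_vec n" for y
    using M u that by (simp add: quadratic_form_sum[of _ n] sum_distrib_left sum_distrib_right mult_ac)
  have right: "(M *\<^sub>v x) \<bullet>c (c \<cdot>\<^sub>v u) = cnj c * ((M *\<^sub>v x) \<bullet>c u)" if "x \<in> carrier_vec n" for x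
    using M u that by (simp add: quadratic_form_sum[of _ n] sum_distrib_left sum_distrib_right mult_ac)
  have "(M *\<^sub>v (c \<cdot>\<^sub>v u)) \<bullet>c (c \<cdot>\<^sub>v u) = 1"
    using u cc by (simp add: left right r mult_ac)
  then have "\<forall>i<Suc k. \<forall>j<Suc k. (M *\<^sub>v w' i) \<bullet>c w' j = (if i = j then 1 else 0)"
    using w u by (auto simp: w'_def less_Suc_eq orth left right uw wu)
  moreover have "\<forall>i<Suc k. w' i \<in> carrier_vec n \<and> (\<forall>j<n. i < j \<longrightarrow> w' i $ j = 0)"
    using w u tri tri_u by (auto simp: w'_def less_Suc_eq)
  ultimately show ?case by blast
qed simp

text \<open>The columns of W are the orthonormal vectors, so the entries of W^* M W are their mutual
  inner products. W serves as an inverse square root of M.\<close>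

lemma posdef_congruent_one:
  assumes psd: "psd n M"
    and pos: "\<And>v. v \<in> carrier_vec n \<Longrightarrow> v \<noteq> 0\<^sub>v n \<Longrightarrow> (M *\<^sub>v v) \<bullet>c v \<noteq> 0"
  obtains W where "W \<in> carrier_mat n n" "mat_adjoint W * M * W = 1\<^sub>m n"
proof -
  obtain w where w: "\<And>i. i < n \<Longrightarrow> w i \<in> carrier_vec n"
    and orth: "\<And>i j. i < n \<Longrightarrow> j < n \<Longrightarrow> (M *\<^sub>v w i) \<bullet>c w j = (if i = j then 1 else 0)"
    using posdef_orthonormal_family[OF psd pos order_refl] by blast
  have M: "M \<in> carrier_mat n n" using psd by (simp add: psd_def)
  define W where "W = mat n n (\<lambda>(i, j). w j $ i)"
  have W: "W \<in> carrier_mat n n" by (simp add: W_def)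
  have Wunit: "W *\<^sub>v unit_vec n j = w j" if "j < n" for j
    using w[OF that] W that by (intro eq_vecI) (auto simp: W_def)
  have "mat_adjoint W * M * W = 1\<^sub>m n"
  proof (rule eq_matI)
    fix i j assume "i < dim_row (1\<^sub>m n)" "j < dim_col (1\<^sub>m n)"
    then have ij: "i < n" "j < n" by simp_all
    have "(mat_adjoint W * M * W) $$ (i, j) = ((mat_adjoint W * M * W) *\<^sub>v unit_vec n j) \<bullet>c unit_vec n i"
      using W M ij by (intro quadratic_form_unit_vec[symmetric]) auto
    also have "\<dots> = (M *\<^sub>v w j) \<bullet>c w i"
      using ij by (simp add: congruence_cscalar[OF M W] Wunit)
    finally show "(mat_adjoint W * M * W) $$ (i, j) = 1\<^sub>m n $$ (i, j)"
      using ij orth by auto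
  qed (use W in auto)
  with W show ?thesis by (rule that)
qed

section \<open>Vectors as operators applied to the maximally entangled vector\<close>

lemma phi_vec_carrier [simp]: "phi_vec d \<in> carrier_vec (d * d)"
  unfolding phi_vec_def by (intro finsum_vec_closed) (auto simp: tensor_vec_def)

lemma dim_phi_vec [simp]: "dim_vec (phi_vec d) = d * d"
  using carrier_vecD[OF phi_vec_carrier] .

lemma index_phi_vec:
  assumes "i < d" "j < d"
  shows "phi_vec d $ (i * d + j) = (if i = j then 1 else 0)"
proof -
  have "phi_vec d $ (i * d + j) = (\<Sum>a<d. tensor_vec (unit_vec d a) (unit_vec d a) $ (i * d + j))"
    unfolding phi_vec_def using assms
    by (intro index_finsum_vec) (auto simp: mult_add_less_mult tensor_vec_def)
  also have "\<dots> = (\<Sum>a<d. if a = i then if i = j then 1 else 0 else 0)"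
    using assms by (intro sum.cong) (auto simp: tensor_vec_def mult_add_less_mult)
  finally show ?thesis using assms by simp
qed

text \<open>Applying 1 \<otimes> M to \<Phi> stacks the columns of M: block i of the result is
  column i.\<close>

lemma index_tensor_phi:
  assumes M: "M \<in> carrier_mat n d" and ik: "i < d" "k < n"
  shows "(tensor_mat (1\<^sub>m d) M *\<^sub>v phi_vec d) $ (i * n + k) = M $$ (k, i)"
proof -
  have "(tensor_mat (1\<^sub>m d) M *\<^sub>v phi_vec d) $ (i * n + k)
      = (\<Sum>s<d * d. tensor_mat (1\<^sub>m d) M $$ (i * n + k, s) * phi_vec d $ s)"
    using M ik
    by (simp add: mult_add_less_mult scalar_prod_def atLeast0LessThan)
  also have "\<dots> = (\<Sum>j<d. \<Sum>l<d. if l = j then if j = i then M $$ (k, l) else 0 else 0)"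
    unfolding sum_lessThan_mult using M ik
    by (intro sum.cong refl) (auto simp: index_tensor_mat[of _ d d M n d] index_phi_vec)
  finally show ?thesis using ik by simp
qed

text \<open>Stacking columns is an isometry for the Hilbert-Schmidt norm.\<close>

lemma tensor_phi_norm:
  assumes M: "M \<in> carrier_mat n d"
  shows "(tensor_mat (1\<^sub>m d) M *\<^sub>v phi_vec d) \<bullet>c (tensor_mat (1\<^sub>m d) M *\<^sub>v phi_vec d)
    = mat_trace (mat_adjoint M * M)"
proof -
  have "dim_vec (tensor_mat (1\<^sub>m d) M *\<^sub>v phi_vec d) = d * n" using M by simp
  then show ?thesis
    unfolding hs_inner_sum[OF M M] cscalar_sum using M
    by (simp add: sum_lessThan_mult index_tensor_phi[OF M] mult.commute del: index_mult_mat_vec)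
qed

text \<open>M is read off by cutting v into d columns of length n; it is rectangular when n differs
  from d.\<close>

lemma vector_eq_tensor_phi:
  assumes "v \<in> carrier_vec (d * n)"
  obtains M where "M \<in> carrier_mat n d" "tensor_mat (1\<^sub>m d) M *\<^sub>v phi_vec d = v"
proof
  define M where "M = mat n d (\<lambda>(k, i). v $ (i * n + k))"
  show M: "M \<in> carrier_mat n d" by (simp add: M_def)
  show "tensor_mat (1\<^sub>m d) M *\<^sub>v phi_vec d = v"
  proof (rule eq_vecI)
    fix s assume "s < dim_vec v"
    then have "s < d * n" using assms by simp
    then show "(tensor_mat (1\<^sub>m d) M *\<^sub>v phi_vec d) $ s = v $ s"
    proof (rule lessThan_mult_cases)
      fix i k assume "s = i * n + k" "i < d" "k < n"
      then show ?thesis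
        using index_tensor_phi[OF M, of i k] by (simp add: M_def del: index_mult_mat_vec)
    qed
  qed (use M assms in auto)
qed

text \<open>Used in both directions: with \<rho> = 1 to create a density operator, and with B^*
  \<rho> B = 1 to remove one.\<close>

lemma tensor_one_congruence:
  assumes B: "B \<in> carrier_mat q r" and \<rho>: "\<rho> \<in> carrier_mat q q" and T: "T \<in> carrier_mat (p * q) (p * q)"
  shows "mat_adjoint (tensor_mat (1\<^sub>m p) B) * (tensor_mat (1\<^sub>m p) \<rho> + T) * tensor_mat (1\<^sub>m p) B
    = tensor_mat (1\<^sub>m p) (mat_adjoint B * \<rho> * B)
      + mat_adjoint (tensor_mat (1\<^sub>m p) B) * T * tensor_mat (1\<^sub>m p) B"
proof -
  let ?A = "tensor_mat (1\<^sub>m p) B"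
  let ?R = "tensor_mat (1\<^sub>m p) \<rho>"
  have A: "?A \<in> carrier_mat (p * q) (p * r)" "mat_adjoint ?A \<in> carrier_mat (p * r) (p * q)"
    and R: "?R \<in> carrier_mat (p * q) (p * q)"
    using B \<rho> by auto
  have "mat_adjoint ?A * ?R = tensor_mat (1\<^sub>m p) (mat_adjoint B * \<rho>)"
    unfolding tensor_mat_adjoint[OF one_carrier_mat B]
    using tensor_mat_mult[OF one_carrier_mat one_carrier_mat mat_adjoint_carrier[OF B] \<rho>] by simp
  then have "mat_adjoint ?A * ?R * ?A = tensor_mat (1\<^sub>m p) (mat_adjoint B * \<rho> * B)"
    using tensor_mat_mult[OF one_carrier_mat one_carrier_mat mult_carrier_mat[OF mat_adjoint_carrier[OF B] \<rho>] B]
    by simp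
  then show ?thesis
    unfolding mult_add_distrib_mat[OF A(2) R T]
      add_mult_distrib_mat[OF mult_carrier_mat[OF A(2) R] mult_carrier_mat[OF A(2) T] A(1)] by simp
qed

lemma quadratic_form_mix_one:
  fixes M :: "complex mat"
  assumes M: "M \<in> carrier_mat n n" and v: "v \<in> carrier_vec n"
  shows "((a \<cdot>\<^sub>m M + b \<cdot>\<^sub>m 1\<^sub>m n) *\<^sub>v v) \<bullet>c v = a * ((M *\<^sub>v v) \<bullet>c v) + b * (v \<bullet>c v)"
proof -
  have aM: "a \<cdot>\<^sub>m M \<in> carrier_mat n n" and b1: "b \<cdot>\<^sub>m 1\<^sub>m n \<in> carrier_mat n n"
    using M by auto
  have "((a \<cdot>\<^sub>m M + b \<cdot>\<^sub>m 1\<^sub>m n) *\<^sub>v v) \<bullet>c v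
      = ((a \<cdot>\<^sub>m M) *\<^sub>v v) \<bullet>c v + ((b \<cdot>\<^sub>m 1\<^sub>m n) *\<^sub>v v) \<bullet>c v"
    unfolding add_mult_distrib_mat_vec[OF aM b1 v]
    by (rule add_scalar_prod_distrib[OF mult_mat_vec_carrier[OF aM v] mult_mat_vec_carrier[OF b1 v]])
      (use v in simp)
  then show ?thesis
    unfolding smult_mat_cscalar[OF M v v] smult_mat_cscalar[OF one_carrier_mat v v] using v by simp
qed

section \<open>Correspondence between feasible pairs and unit vectors\<close>

context
  fixes d :: nat and S :: "complex mat set"
  assumes d: "1 \<le> d" and S: "S \<subseteq> carrier_mat d d" "1\<^sub>m d \<in> S"
begin

abbreviation "ampl n \<equiv> tensor_space d n S (carrier_mat n n)"

lemma ampl_perp: "hs_perp (d * n) (ampl n) = tensor_space d n (hs_perp d S) (carrier_mat n n)"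
  by (rule hs_perp_tensor_space[OF S(1)])

text \<open>Congruence by 1 \<otimes> M, where M stacks to v, turns 1 + T into 1 \<otimes> \<rho> +
  T' with \<rho> = M^* M, and the trace of \<rho> is the squared norm of v. The result lives in
  dimension d * d whatever n is.\<close>

lemma feasible_of_vector:
  assumes T: "T \<in> hs_perp (d * n) (ampl n)" and psd: "psd (d * n) (1\<^sub>m (d * n) + T)"
    and v: "v \<in> carrier_vec (d * n)" "hilbert_norm v = 1"
  obtains \<rho> T' where "feasible d S \<rho> T'" "objective d \<rho> T' = ((1\<^sub>m (d * n) + T) *\<^sub>v v) \<bullet>c v"
proof -
  obtain M where M: "M \<in> carrier_mat n d" and Mv: "tensor_mat (1\<^sub>m d) M *\<^sub>v phi_vec d = v"
    using vector_eq_tensor_phi[OF v(1)] .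
  let ?A = "tensor_mat (1\<^sub>m d) M"
  have A: "?A \<in> carrier_mat (d * n) (d * d)" using M by auto
  have T_carrier: "T \<in> carrier_mat (d * n) (d * n)" using T hs_perp_carrier by auto
  define \<rho> where "\<rho> = mat_adjoint M * M"
  define T' where "T' = mat_adjoint ?A * T * ?A"
  have sum: "tensor_mat (1\<^sub>m d) \<rho> + T' = mat_adjoint ?A * (1\<^sub>m (d * n) + T) * ?A"
    using tensor_one_congruence[OF M one_carrier_mat T_carrier] right_mult_one_mat[OF mat_adjoint_carrier[OF M]]
    by (simp add: \<rho>_def T'_def tensor_mat_one)
  have "feasible d S \<rho> T'"
    unfolding feasible_def
  proof (intro conjI)
    show "T' \<in> tensor_space d d (hs_perp d S) (carrier_mat d d)"
      unfolding T'_def using T M by (intro tensor_space_congruence hs_perp_carrier) (simp add: ampl_perp)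
    have "mat_trace \<rho> = complex_of_real ((hilbert_norm v)\<^sup>2)"
      using tensor_phi_norm[OF M] unfolding Mv \<rho>_def hilbert_norm_power2
      by (metis cscalar_self Re_complex_of_real)
    then show "mat_trace \<rho> = 1" using v by simp
    show "psd (d * d) (tensor_mat (1\<^sub>m d) \<rho> + T')"
      unfolding sum by (rule psd_congruence[OF psd A])
    show "psd d \<rho>"
      using psd_congruence[OF psd_one M] right_mult_one_mat[OF mat_adjoint_carrier[OF M]] by (simp add: \<rho>_def)
    show "\<rho> \<in> carrier_mat d d" unfolding \<rho>_def using mult_carrier_mat[OF mat_adjoint_carrier[OF M] M] .
  qed
  moreover have "objective d \<rho> T' = ((1\<^sub>m (d * n) + T) *\<^sub>v v) \<bullet>c v"
    unfolding objective_def sum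
    by (subst congruence_cscalar[OF _ A]) (use T_carrier Mv in auto)
  ultimately show ?thesis by (rule that)
qed

text \<open>Inverts the preceding construction by congruence with 1 \<otimes> W, where W^* \<rho> W
  = 1. Definiteness of \<rho> provides W.\<close>

lemma vector_of_feasible:
  assumes feas: "feasible d S \<rho> T'"
    and pos: "\<And>v. v \<in> carrier_vec d \<Longrightarrow> v \<noteq> 0\<^sub>v d \<Longrightarrow> (\<rho> *\<^sub>v v) \<bullet>c v \<noteq> 0"
  obtains T v where "T \<in> hs_perp (d * d) (ampl d)" "psd (d * d) (1\<^sub>m (d * d) + T)"
    "v \<in> carrier_vec (d * d)" "hilbert_norm v = 1"
    "objective d \<rho> T' = ((1\<^sub>m (d * d) + T) *\<^sub>v v) \<bullet>c v"
proof -
  let ?N = "tensor_mat (1\<^sub>m d) \<rho> + T'"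
  have \<rho>: "\<rho> \<in> carrier_mat d d" "psd d \<rho>" "mat_trace \<rho> = 1"
    and T': "T' \<in> tensor_space d d (hs_perp d S) (carrier_mat d d)"
    and psd: "psd (d * d) ?N"
    using feas by (auto simp: feasible_def)
  have T'_carrier: "T' \<in> carrier_mat (d * d) (d * d)"
    using tensor_space_carrier[OF hs_perp_carrier subset_refl T'] .
  obtain W where W: "W \<in> carrier_mat d d" and W\<rho>W: "mat_adjoint W * \<rho> * W = 1\<^sub>m d"
    using posdef_congruent_one[OF \<rho>(2) pos] .
  \<comment> \<open>By the choice of W this is a left inverse of W, hence, the matrices being
    square, its two-sided inverse.\<close>
  define M where "M = mat_adjoint W * \<rho>"
  have M: "M \<in> carrier_mat d d" unfolding M_def using mult_carrier_mat[OF mat_adjoint_carrier[OF W] \<rho>(1)] .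
  have WM: "W * M = 1\<^sub>m d"
    using W\<rho>W M W by (intro mat_mult_left_right_inverse[of M]) (auto simp: M_def)
  \<comment> \<open>Replacing the second factor by W^* \<rho> gives M^* W^* \<rho>, the adjoint of W
    M = 1 times \<rho>.\<close>
  have "mat_adjoint M * M = mat_adjoint M * (mat_adjoint W * \<rho>)"
    by (simp add: M_def)
  also have "\<dots> = mat_adjoint (W * M) * \<rho>"
    unfolding mat_adjoint_mult[OF W M]
    by (rule assoc_mult_mat[symmetric, OF mat_adjoint_carrier[OF M] mat_adjoint_carrier[OF W] \<rho>(1)])
  finally have MM: "mat_adjoint M * M = \<rho>"
    unfolding WM using \<rho>(1) by simp
  let ?A = "tensor_mat (1\<^sub>m d) W"
  let ?B = "tensor_mat (1\<^sub>m d) M"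
  have A: "?A \<in> carrier_mat (d * d) (d * d)" and B: "?B \<in> carrier_mat (d * d) (d * d)"
    using W M by auto
  have AB: "?A * ?B = 1\<^sub>m (d * d)"
    using tensor_mat_mult[OF one_carrier_mat one_carrier_mat W M] by (simp add: WM tensor_mat_one)
  define T where "T = mat_adjoint ?A * T' * ?A"
  define v where "v = ?B *\<^sub>v phi_vec d"
  have Av: "?A *\<^sub>v v = phi_vec d"
    unfolding v_def using assoc_mult_mat_vec[OF A B phi_vec_carrier] AB by simp
  have sum: "1\<^sub>m (d * d) + T = mat_adjoint ?A * ?N * ?A"
    unfolding tensor_one_congruence[OF W \<rho>(1) T'_carrier] W\<rho>W by (simp add: T_def tensor_mat_one)
  have v: "v \<in> carrier_vec (d * d)" unfolding v_def using B by simp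
  show ?thesis
  proof (rule that[OF _ _ v])
    show "T \<in> hs_perp (d * d) (ampl d)"
      unfolding ampl_perp T_def using T' W by (intro tensor_space_congruence hs_perp_carrier)
    show "psd (d * d) (1\<^sub>m (d * d) + T)"
      unfolding sum by (rule psd_congruence[OF psd A])
    show "hilbert_norm v = 1"
      unfolding hilbert_norm_def v_def tensor_phi_norm[OF M] MM \<rho>(3) by simp
    show "objective d \<rho> T' = ((1\<^sub>m (d * d) + T) *\<^sub>v v) \<bullet>c v"
      unfolding sum objective_def
      by (subst congruence_cscalar[OF _ A v v]) (use psd Av in \<open>auto simp: psd_def\<close>)
  qed
qed

text \<open>
  Mixing \<open>\<rho>\<close> with the maximally mixed state makes it invertible and moves the objective towards 1.
\<close>

lemma feasible_mix:
  assumes feas: "feasible d S \<rho> T'" and \<epsilon>: "0 < \<epsilon>" "\<epsilon> \<le> 1"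
  obtains \<rho>' T'' where "feasible d S \<rho>' T''"
    "\<And>v. v \<in> carrier_vec d \<Longrightarrow> v \<noteq> 0\<^sub>v d \<Longrightarrow> (\<rho>' *\<^sub>v v) \<bullet>c v \<noteq> 0"
    "objective d \<rho>' T'' = complex_of_real (1 - \<epsilon>) * objective d \<rho> T' + complex_of_real \<epsilon>"
proof -
  let ?N = "tensor_mat (1\<^sub>m d) \<rho> + T'"
  have \<rho>: "\<rho> \<in> carrier_mat d d" "psd d \<rho>" "mat_trace \<rho> = 1"
    and T': "T' \<in> tensor_space d d (hs_perp d S) (carrier_mat d d)"
    and psd: "psd (d * d) ?N"
    using feas by (auto simp: feasible_def)
  have T'_carrier: "T' \<in> carrier_mat (d * d) (d * d)"
    using tensor_space_carrier[OF hs_perp_carrier subset_refl T'] .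
  \<comment> \<open>The weights satisfy a + b d = 1, which keeps the trace of \<rho>' at 1; T' is
    scaled by a alone.\<close>
  define a where "a = complex_of_real (1 - \<epsilon>)"
  define b where "b = complex_of_real (\<epsilon> / d)"
  have ab: "0 \<le> a" "0 < b" "b * of_nat d = complex_of_real \<epsilon>" "a + b * of_nat d = 1"
    using \<epsilon> d by (auto simp: a_def b_def less_eq_complex_def less_complex_def)
  define \<rho>' where "\<rho>' = a \<cdot>\<^sub>m \<rho> + b \<cdot>\<^sub>m 1\<^sub>m d"
  have N_carrier: "?N \<in> carrier_mat (d * d) (d * d)" using psd by (simp add: psd_def)
  have R_carrier: "tensor_mat (1\<^sub>m d) \<rho> \<in> carrier_mat (d * d) (d * d)" using \<rho> by auto
  have N': "tensor_mat (1\<^sub>m d) \<rho>' + a \<cdot>\<^sub>m T' = a \<cdot>\<^sub>m ?N + b \<cdot>\<^sub>m 1\<^sub>m (d * d)"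
  proof -
    have "tensor_mat (1\<^sub>m d) \<rho>' = a \<cdot>\<^sub>m tensor_mat (1\<^sub>m d) \<rho> + b \<cdot>\<^sub>m 1\<^sub>m (d * d)"
      unfolding \<rho>'_def tensor_mat_add_right[OF one_carrier_mat smult_carrier_mat[OF \<rho>(1)] smult_carrier_mat[OF one_carrier_mat]]
        tensor_mat_smult_right[OF one_carrier_mat \<rho>(1)] tensor_mat_smult_right[OF one_carrier_mat one_carrier_mat]
        tensor_mat_one ..
    moreover have "a \<cdot>\<^sub>m R + b \<cdot>\<^sub>m 1\<^sub>m (d * d) + a \<cdot>\<^sub>m T' = a \<cdot>\<^sub>m (R + T') + b \<cdot>\<^sub>m 1\<^sub>m (d * d)"
      if "R \<in> carrier_mat (d * d) (d * d)" for R
      using that T'_carrier by (intro eq_matI) (auto simp: distrib_left)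
    ultimately show ?thesis
      using R_carrier by simp
  qed
  have "feasible d S \<rho>' (a \<cdot>\<^sub>m T')"
    unfolding feasible_def N'
  proof (intro conjI)
    show "\<rho>' \<in> carrier_mat d d" using \<rho> by (simp add: \<rho>'_def)
    show "a \<cdot>\<^sub>m T' \<in> tensor_space d d (hs_perp d S) (carrier_mat d d)"
      by (rule tensor_space_smult[OF hs_perp_carrier subset_refl T'])
    show "mat_trace \<rho>' = 1"
      using \<rho> ab by (simp add: \<rho>'_def mat_trace_add[of _ d] mat_trace_smult[of _ d] mat_trace_one)
    show "psd (d * d) (a \<cdot>\<^sub>m ?N + b \<cdot>\<^sub>m 1\<^sub>m (d * d))"
      using ab by (intro psd_add[OF psd_smult[OF psd] psd_smult[OF psd_one]]) auto
    show "psd d \<rho>'"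
      unfolding \<rho>'_def using ab \<rho> by (intro psd_add psd_smult psd_one) auto
  qed
  moreover have "(\<rho>' *\<^sub>v v) \<bullet>c v \<noteq> 0" if v: "v \<in> carrier_vec d" "v \<noteq> 0\<^sub>v d" for v
  proof -
    have "(\<rho>' *\<^sub>v v) \<bullet>c v = a * ((\<rho> *\<^sub>v v) \<bullet>c v) + b * (v \<bullet>c v)"
      unfolding \<rho>'_def by (rule quadratic_form_mix_one[OF \<rho>(1) v(1)])
    moreover have "0 \<le> a * ((\<rho> *\<^sub>v v) \<bullet>c v)"
      using ab \<rho> v by (simp add: psd_def)
    moreover have "0 < b * (v \<bullet>c v)"
    proof -
      have "0 < v \<bullet>c v" using v by simp
      then show ?thesis using ab(2) by (simp add: less_complex_def)
    qed
    ultimately show ?thesis by (metis add_nonneg_pos less_irrefl)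
  qed
  moreover have "objective d \<rho>' (a \<cdot>\<^sub>m T') = a * objective d \<rho> T' + complex_of_real \<epsilon>"
  proof -
    have "objective d \<rho>' (a \<cdot>\<^sub>m T') = a * objective d \<rho> T' + b * (phi_vec d \<bullet>c phi_vec d)"
      unfolding objective_def N' by (rule quadratic_form_mix_one[OF N_carrier phi_vec_carrier])
    \<comment> \<open>\<Phi> has squared norm d, so the identity term contributes b d =
      \<epsilon>.\<close>
    moreover have "phi_vec d \<bullet>c phi_vec d = of_nat d"
      using tensor_phi_norm[of "1\<^sub>m d" d d] phi_vec_carrier[of d] by (simp add: tensor_mat_one mat_trace_one)
    ultimately show ?thesis using ab(3) by simp
  qed
  ultimately show ?thesis unfolding a_def by (rule that)
qed

lemma ampl_carrier: "ampl n \<subseteq> carrier_mat (d * n) (d * n)"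
  using tensor_space_carrier[OF S(1) subset_refl] by blast

lemma one_in_ampl: "1\<^sub>m (d * n) \<in> ampl n"
  using tensor_space_gen[OF S(1) subset_refl S(2) one_carrier_mat] by (simp add: tensor_mat_one)

text \<open>Each mixture has definite \<rho>' and thus corresponds to an admissible pair (T, v) for
  n = d; letting \<epsilon> tend to 0 gives the bound for \<rho> itself.\<close>

lemma objective_le_lovasz:
  assumes feas: "feasible d S \<rho> T'"
  shows "Re (objective d \<rho> T') \<le> lovasz (d * d) (ampl d)"
proof -
  have dd: "1 \<le> d * d" using d by simp
  obtain T v where max: "\<And>T v. T \<in> hs_perp (d * d) (ampl d) \<Longrightarrow> psd (d * d) (1\<^sub>m (d * d) + T) \<Longrightarrow>
      v \<in> carrier_vec (d * d) \<Longrightarrow> hilbert_norm v = 1 \<Longrightarrow>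
      Re (((1\<^sub>m (d * d) + T) *\<^sub>v v) \<bullet>c v) \<le> lovasz (d * d) (ampl d)"
    using lovasz_attained[OF dd ampl_carrier one_in_ampl] by metis
  have "(1 - \<epsilon>) * Re (objective d \<rho> T') + \<epsilon> \<le> lovasz (d * d) (ampl d)" if \<epsilon>: "0 < \<epsilon>" "\<epsilon> \<le> 1" for \<epsilon>
  proof -
    obtain \<rho>' T'' where mix: "feasible d S \<rho>' T''"
        "\<And>v. v \<in> carrier_vec d \<Longrightarrow> v \<noteq> 0\<^sub>v d \<Longrightarrow> (\<rho>' *\<^sub>v v) \<bullet>c v \<noteq> 0"
        "objective d \<rho>' T'' = complex_of_real (1 - \<epsilon>) * objective d \<rho> T' + complex_of_real \<epsilon>"
      using feasible_mix[OF feas \<epsilon>] by metis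
    obtain T v where "T \<in> hs_perp (d * d) (ampl d)" "psd (d * d) (1\<^sub>m (d * d) + T)"
        "v \<in> carrier_vec (d * d)" "hilbert_norm v = 1"
      and obj: "objective d \<rho>' T'' = ((1\<^sub>m (d * d) + T) *\<^sub>v v) \<bullet>c v"
      using vector_of_feasible[OF mix(1,2)] by metis
    then have "Re (objective d \<rho>' T'') \<le> lovasz (d * d) (ampl d)"
      using max by simp
    then show ?thesis by (simp add: mix(3))
  qed
  \<comment> \<open>The bound holds for all \<epsilon> in (0, 1], hence near 0 from the right, and a
    limit preserves it.\<close>
  then have "eventually (\<lambda>\<epsilon>. (1 - \<epsilon>) * Re (objective d \<rho> T') + \<epsilon> \<le> lovasz (d * d) (ampl d)) (at_right 0)"
    using eventually_at_right[of 0 "1 :: real"] by (auto intro!: exI[of _ "1 :: real"])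
  moreover have "((\<lambda>\<epsilon>. (1 - \<epsilon>) * Re (objective d \<rho> T') + \<epsilon>) \<longlongrightarrow>
      (1 - 0) * Re (objective d \<rho> T') + 0) (at_right (0 :: real))"
    by (intro tendsto_intros)
  ultimately show ?thesis
    using tendsto_upperbound[of _ _ "at_right (0 :: real)"] by fastforce
qed

text \<open>A maximizing pair (T, v) for any n yields a feasible pair of equal value. General n
  gives the upper bound on the supremum, n = d the attainment of the maximum.\<close>

lemma feasible_attaining_lovasz:
  assumes "1 \<le> n"
  obtains \<rho> T' where "feasible d S \<rho> T'" "Re (objective d \<rho> T') = lovasz (d * n) (ampl n)"
proof -
  have dn: "1 \<le> d * n" using d assms by simp
  obtain T v where "T \<in> hs_perp (d * n) (ampl n)" "psd (d * n) (1\<^sub>m (d * n) + T)"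
      "v \<in> carrier_vec (d * n)" "hilbert_norm v = 1"
    and val: "Re (((1\<^sub>m (d * n) + T) *\<^sub>v v) \<bullet>c v) = lovasz (d * n) (ampl n)"
    using lovasz_attained[OF dn ampl_carrier one_in_ampl] by metis
  then show ?thesis
    using feasible_of_vector that by metis
qed

end

text \<open>The objective is the form of a positive operator at \<Phi>, so comparing real parts
  suffices.\<close>

lemma objective_real:
  assumes "feasible d S \<rho> T'"
  shows "objective d \<rho> T' = complex_of_real (Re (objective d \<rho> T'))"
proof -
  have "0 \<le> objective d \<rho> T'"
    using assms phi_vec_carrier[of d] unfolding feasible_def psd_def objective_def by blast
  then show ?thesis by (simp add: complex_eq_iff less_eq_complex_def)
qed

theorem theorem8:
  fixes d :: nat and S :: "complex mat set"
  assumes "d \<ge> 1" and "nc_graph d S"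
  shows "\<exists>x :: real.
    quantum_lovasz d S = ereal x \<and>
    (\<exists>\<rho> T'. feasible d S \<rho> T' \<and> objective d \<rho> T' = complex_of_real x) \<and>
    (\<forall>\<rho> T'. feasible d S \<rho> T' \<longrightarrow> objective d \<rho> T' \<le> complex_of_real x)"
proof -
  have S: "S \<subseteq> carrier_mat d d" "1\<^sub>m d \<in> S"
    using assms(2) submodule.subset[of _ S "module_mat TYPE(complex) d d"]
    by (auto simp: nc_graph_def subspace_def module_mat_simps)
  \<comment> \<open>The term n = d of the supremum serves as the common value.\<close>
  let ?x = "lovasz (d * d) (ampl d S d)"
  have bound: "Re (objective d \<rho> T') \<le> ?x" if "feasible d S \<rho> T'" for \<rho> T'
    by (rule objective_le_lovasz[OF assms(1) S that])
  have "quantum_lovasz d S = ereal ?x"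
    unfolding quantum_lovasz_def
  proof (rule antisym)
    show "(SUP n\<in>{1..}. ereal (lovasz (d * n) (ampl d S n))) \<le> ereal ?x"
    proof (rule SUP_least)
      fix n :: nat assume "n \<in> {1..}"
      then obtain \<rho> T' where "feasible d S \<rho> T'" "Re (objective d \<rho> T') = lovasz (d * n) (ampl d S n)"
        using feasible_attaining_lovasz[OF assms(1) S, of n] by auto
      then show "ereal (lovasz (d * n) (ampl d S n)) \<le> ereal ?x"
        using bound by force
    qed
    show "ereal ?x \<le> (SUP n\<in>{1..}. ereal (lovasz (d * n) (ampl d S n)))"
      using assms(1) by (intro SUP_upper2[of d]) auto
  qed
  moreover have "\<exists>\<rho> T'. feasible d S \<rho> T' \<and> objective d \<rho> T' = complex_of_real ?x"
    using feasible_attaining_lovasz[OF assms(1) S assms(1)] objective_real by metis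
  \<comment> \<open>The order on complex numbers also demands equal imaginary parts, so the
    objective is first rewritten as a real number.\<close>
  moreover have "objective d \<rho> T' \<le> complex_of_real ?x" if "feasible d S \<rho> T'" for \<rho> T'
    using bound[OF that] by (subst objective_real[OF that]) (simp add: less_eq_complex_def)
  ultimately show ?thesis by blast
qed

end
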